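(* There is a polynomial $p$ (independent of $u$) such that the following holds. Let $u \in F_2$ be a word whose length is irreducible by any automorphism of $F_2$, i.e. $|\phi(u)| \ge |u|$ for every $\phi \in \mathrm{Aut}(F_2)$. Then the number of automorphic images of $u$ that have the same length as $u$, i.e. the cardinality of the set $\{ v \in F_2 : |v| = |u| \text{ and } v = \phi(u) \text{ for some } \phi \in \mathrm{Aut}(F_2)\}$, is at most $p(|u|)$.
   Context: $F_2$ is the free group of rank 2 with a fixed free basis, and $|u|$ denotes the length of the reduced word in the basis elements and their inverses representing $u$. *)

theory Defs
  imports "HOL-Algebra.Bij" "HOL-Computational_Algebra.Polynomial"
begin

text \<open>
  The pair \<open>(x, True)\<close> is the letter \<open>x\<close>, the pair \<open>(x, False)\<close> its formal inverse.
\<close>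

type_synonym 'b letter = "'b \<times> bool"

fun inv_letter :: "'b letter \<Rightarrow> 'b letter" where
  "inv_letter (x, e) = (x, \<not> e)"

definition reduced :: "'b letter list \<Rightarrow> bool" where
  "reduced w \<longleftrightarrow> successively (\<lambda>a b. b \<noteq> inv_letter a) w"

fun push :: "'b letter \<Rightarrow> 'b letter list \<Rightarrow> 'b letter list" where
  "push a [] = [a]"
| "push a (b # w) = (if b = inv_letter a then w else a # b # w)"

definition reduce :: "'b letter list \<Rightarrow> 'b letter list" where
  "reduce w = foldr push w []"

text \<open>
  The free group on the whole type \<open>'b\<close>. Its elements are the reduced words themselves,
  so the length of an element with respect to the basis is the library's \<^const>\<open>length\<close>.
\<close>

definition free_group :: "'b letter list monoid" where
  "free_group = \<lparr>carrier = {w. reduced w}, monoid.mult = (\<lambda>u v. reduce (u @ v)), one = []\<rparr>"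

datatype gen2 = GenA | GenB

abbreviation F2 :: "gen2 letter list monoid" where
  "F2 \<equiv> free_group"

lemma inv_letter_invol [simp]: "inv_letter (inv_letter a) = a"
  by (cases a) auto

lemma reduced_Nil [simp]: "reduced []"
  by (simp add: reduced_def)

lemma reduced_push: "reduced w \<Longrightarrow> reduced (push a w)"
  by (cases w) (auto simp: reduced_def successively_Cons)

lemma reduced_foldr_push: "reduced z \<Longrightarrow> reduced (foldr push w z)"
  by (induction w) (auto intro: reduced_push)

lemma reduced_reduce: "reduced (reduce w)"
  by (simp add: reduce_def reduced_foldr_push)

lemma reduced_ConsD: "reduced (a # w) \<Longrightarrow> reduced w"
  by (auto simp: reduced_def successively_Cons)

lemma push_reduced: "reduced (a # w) \<Longrightarrow> push a w = a # w"
  by (cases w) (auto simp: reduced_def)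

lemma reduce_reduced: "reduced w \<Longrightarrow> reduce w = w"
proof (induction w)
  case (Cons a w)
  then have "reduce w = w" by (blast dest: reduced_ConsD)
  then show ?case using push_reduced[OF Cons.prems] by (simp add: reduce_def)
qed (simp add: reduce_def)

lemma push_push_inv: "reduced z \<Longrightarrow> push a (push (inv_letter a) z) = z"
  by (cases z) (auto simp: push_reduced)

lemma foldr_push_push:
  assumes "reduced z"
  shows "foldr push (push a w) z = push a (foldr push w z)"
proof (cases w)
  case (Cons b v)
  show ?thesis
  proof (cases "b = inv_letter a")
    case True
    have "reduced (foldr push v z)"
      using assms by (rule reduced_foldr_push)
    then show ?thesis
      using True Cons by (simp add: push_push_inv)
  qed (use Cons in simp)
qed simp

lemma foldr_push_reduce:
  "reduced z \<Longrightarrow> foldr push (reduce w) z = foldr push w z"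
  by (induction w) (auto simp: reduce_def foldr_push_push)

lemma reduce_append_reduce_left: "reduce (reduce u @ v) = reduce (u @ v)"
  using foldr_push_reduce[OF reduced_reduce, of u v] by (simp add: reduce_def)

lemma reduce_append_reduce_right: "reduce (u @ reduce v) = reduce (u @ v)"
proof -
  have "foldr push (reduce v) [] = foldr push v []"
    by (rule foldr_push_reduce) simp
  then show ?thesis
    by (simp add: reduce_def)
qed

lemma reduce_inverse: "reduce (rev (map inv_letter w) @ w) = []"
proof (induction w)
  case (Cons a w)
  have "push (inv_letter a) (push a (reduce w)) = reduce w"
    using push_push_inv[OF reduced_reduce, of "inv_letter a" w] by simp
  with Cons show ?case by (simp add: reduce_def)
qed (simp add: reduce_def)

lemma group_free_group: "group (free_group :: 'b letter list monoid)"
proof (rule groupI)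
  fix u v w :: "'b letter list"
  assume "u \<in> carrier free_group" "v \<in> carrier free_group" "w \<in> carrier free_group"
  show "u \<otimes>\<^bsub>free_group\<^esub> v \<otimes>\<^bsub>free_group\<^esub> w = u \<otimes>\<^bsub>free_group\<^esub> (v \<otimes>\<^bsub>free_group\<^esub> w)"
    by (simp add: free_group_def reduce_append_reduce_left reduce_append_reduce_right)
next
  fix u :: "'b letter list"
  assume "u \<in> carrier free_group"
  have "reduce (reduce (rev (map inv_letter u)) @ u) = []"
    by (simp add: reduce_append_reduce_left reduce_inverse)
  then show "\<exists>v\<in>carrier free_group. v \<otimes>\<^bsub>free_group\<^esub> u = \<one>\<^bsub>free_group\<^esub>"
    by (intro bexI[of _ "reduce (rev (map inv_letter u))"])
      (simp_all add: free_group_def reduced_reduce)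
qed (auto simp: free_group_def reduced_reduce reduce_reduced)

text \<open>The universal property: the one-letter words form a free basis.\<close>

fun letter_value :: "('a, 'm) monoid_scheme \<Rightarrow> ('b \<Rightarrow> 'a) \<Rightarrow> 'b letter \<Rightarrow> 'a" where
  "letter_value G f (x, e) = (if e then f x else inv\<^bsub>G\<^esub> (f x))"

definition word_value :: "('a, 'm) monoid_scheme \<Rightarrow> ('b \<Rightarrow> 'a) \<Rightarrow> 'b letter list \<Rightarrow> 'a" where
  "word_value G f w = foldr (\<lambda>a y. letter_value G f a \<otimes>\<^bsub>G\<^esub> y) w \<one>\<^bsub>G\<^esub>"

context
  fixes G :: "('a, 'm) monoid_scheme" and f :: "'b \<Rightarrow> 'a"
  assumes G: "group G" and f: "\<And>x. f x \<in> carrier G"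
begin

interpretation group G by (rule G)

lemma letter_value_closed: "letter_value G f a \<in> carrier G"
  using f by (cases a) auto

lemma letter_value_inv: "letter_value G f (inv_letter a) = inv\<^bsub>G\<^esub> (letter_value G f a)"
  using f by (cases a) auto

lemma word_value_Nil: "word_value G f [] = \<one>\<^bsub>G\<^esub>"
  by (simp add: word_value_def)

lemma word_value_Cons: "word_value G f (a # w) = letter_value G f a \<otimes>\<^bsub>G\<^esub> word_value G f w"
  by (simp add: word_value_def)

lemma word_value_closed: "word_value G f w \<in> carrier G"
  by (induction w) (auto simp: word_value_Nil word_value_Cons letter_value_closed)

lemma word_value_append: "word_value G f (u @ v) = word_value G f u \<otimes>\<^bsub>G\<^esub> word_value G f v"
  by (induction u)
    (auto simp: word_value_Nil word_value_Cons letter_value_closed word_value_closed m_assoc)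

lemma word_value_push: "word_value G f (push a w) = word_value G f (a # w)"
  by (cases w)
    (auto simp: word_value_Cons letter_value_inv letter_value_closed word_value_closed
      m_assoc[symmetric])

lemma word_value_reduce: "word_value G f (reduce w) = word_value G f w"
  by (induction w) (auto simp: reduce_def word_value_push word_value_Cons)

lemma word_value_hom: "word_value G f \<in> hom free_group G"
  by (rule homI)
    (auto simp: free_group_def word_value_closed word_value_reduce word_value_append)

lemma word_value_basis: "word_value G f [(x, True)] = f x"
  using f by (simp add: word_value_def)

lemma word_value_unique:
  assumes h: "h \<in> hom free_group G" and hf: "\<And>x. h [(x, True)] = f x" and w: "reduced w"
  shows "h w = word_value G f w"
proof -
  interpret h: group_hom free_group G h
    by (intro group_hom.intro group_hom_axioms.intro group_free_group G h)
  have car: "[a] \<in> carrier free_group" for a :: "'b letter"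
    by (simp add: free_group_def reduced_def)
  have letter: "h [a] = letter_value G f a" for a
  proof (cases a)
    case (Pair x e)
    show ?thesis
    proof (cases e)
      case False
      have "inv\<^bsub>free_group\<^esub> [(x, True)] = [(x, False)]"
        by (rule group.inv_equality[OF group_free_group])
          (use car in \<open>auto simp: free_group_def reduce_def\<close>)
      then have "h [(x, False)] = inv\<^bsub>G\<^esub> (f x)"
        using h.hom_inv[OF car, of "(x, True)"] hf by simp
      with False Pair show ?thesis by simp
    qed (use Pair hf in simp)
  qed
  from w show ?thesis
  proof (induction w)
    case Nil
    then show ?case using h.hom_one by (simp add: word_value_Nil free_group_def)
  next
    case (Cons a w)
    have r: "reduced w" using Cons.prems by (rule reduced_ConsD)
    have "[a] \<otimes>\<^bsub>free_group\<^esub> w = a # w"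
      using Cons.prems by (simp add: free_group_def reduce_reduced)
    moreover have "w \<in> carrier free_group"
      using r by (simp add: free_group_def)
    ultimately have "h (a # w) = h [a] \<otimes>\<^bsub>G\<^esub> h w"
      using h.hom_mult[OF car, of w a] by simp
    with Cons.IH[OF r] letter show ?case by (simp add: word_value_Cons)
  qed
qed

end

end

theory Submission
  imports Defs
begin

text \<open>
  Call a word minimal if no automorphism shortens it. The proof follows the cyclic length of a
  minimal word along products of elementary automorphisms.

  Write \<open>twist g m\<close> for the automorphism that fixes the generator \<open>o\<close> other than \<open>g\<close> and sends \<open>g\<close>
  to \<open>g o\<^sup>m\<close>. Up to conjugation, every automorphism of the free group of rank two has the form \<open>\<sigma>
  \<circ> T\<^sub>r \<circ> \<dots> \<circ> T\<^sub>1 \<circ> \<tau>\<close>, where \<open>\<sigma>\<close> and \<open>\<tau>\<close> permute the basis elements and their inverses and each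
  \<open>T\<^sub>i\<close> is one of the two positive twists \<open>twist g 1\<close> (\<open>normal_form_basis\<close>). That every
  automorphism can be reached at all is Nielsen reduction; that all twists can be made positive is
  the relation \<open>twist o 1 \<circ> twist g (-1) = twist g 1\<close> up to conjugation and a signed permutation.
  Signed permutations preserve length, so a minimal word \<open>u\<close> and an image of the same length are
  joined by a positive path of cyclic words that starts and ends at the least possible length.

  The length along such a path is convex (\<open>convexity\<close>). In a cyclically reduced word, let \<open>repeats
  g\<close> be the number of cyclically adjacent pairs of letters that both come from \<open>g\<close>, and let
  \<open>balance\<close> count the adjacent pairs from different generators, with weight \<open>1\<close> if the signs agree
  and \<open>-1\<close> if they differ. For \<open>s = 1\<close> and \<open>s = -1\<close>, \<open>twist g s\<close> changes the cyclic length by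
  \<open>repeats g + s * balance / 2\<close> (\<open>cyclic_length_twist\<close>). Since \<open>balance\<close> does not depend on \<open>g\<close>,
  entering a word by \<open>twist g 1\<close> and leaving it by \<open>twist h 1\<close> gives a second difference \<open>repeats
  g + repeats h\<close>, which is nonnegative. Hence a path that has once gone up never comes down again
  (\<open>climb\<close>), and a path with minimal start and end has constant length.

  On a path of constant length all second differences vanish. If the path changes the generator at
  an interior word, that word has no two adjacent letters from the same generator. From there on
  every twist but the last one fixes the cyclic word (\<open>twist_alternating\<close>), because there every
  gap between letters of the twisted generator is a single letter, and to shift it would either
  empty it, which creates a repeated letter at the next word, or lengthen the word. So the end of
  the path is \<open>T\<^sup>k w\<close> or \<open>T' T\<^sup>k w\<close> with two positive twists \<open>T\<close>, \<open>T'\<close>. Finally \<open>T\<^sup>k\<close> either fixes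
  the cyclic word or shifts some exponent by \<open>k\<close>, so \<open>k \<le> 2 |u|\<close> (\<open>twist_power\<close>). This leaves
  linearly many conjugacy classes of images, and a conjugacy class contains at most linearly many
  words of minimal length, all rotations of each other. The resulting bound is quadratic.
\<close>

section \<open>Words modulo free reduction\<close>

definition inverse_word :: "'b letter list \<Rightarrow> 'b letter list" where
  "inverse_word w = rev (map inv_letter w)"

text \<open>
  All of the following works with arbitrary, not necessarily reduced, words: \<open>\<simeq>\<close> is equality and
  \<open>\<sim>\<close> is conjugacy of the group elements that two words represent.
\<close>

definition free_eq :: "'b letter list \<Rightarrow> 'b letter list \<Rightarrow> bool"  (infix "\<simeq>" 50) where
  "u \<simeq> v \<longleftrightarrow> reduce u = reduce v"

definition conjugate :: "'b letter list \<Rightarrow> 'b letter list \<Rightarrow> bool"  (infix "\<sim>" 50) where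
  "u \<sim> v \<longleftrightarrow> (\<exists>g. u \<simeq> g @ v @ inverse_word g)"

lemma inverse_word_simps [simp]:
  "inverse_word [] = []" "inverse_word (a # w) = inverse_word w @ [inv_letter a]"
    "inverse_word (u @ v) = inverse_word v @ inverse_word u"
  "inverse_word (inverse_word w) = w" "length (inverse_word w) = length w"
    "inverse_word w = [] \<longleftrightarrow> w = []"
  by (auto simp: inverse_word_def rev_map o_def)

lemma inv_letter_neq [simp]: "inv_letter x \<noteq> x" "x \<noteq> inv_letter x"
  by (cases x; auto)+

lemma inv_letter_eq_iff [simp]: "inv_letter x = inv_letter y \<longleftrightarrow> x = y"
  by (metis inv_letter_invol)

lemma fst_inv_letter [simp]: "fst (inv_letter x) = fst x"
  and snd_inv_letter [simp]: "snd (inv_letter x) \<longleftrightarrow> \<not> snd x"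
  by (cases x; simp)+

lemma reduced_append:
  "reduced (u @ v) \<longleftrightarrow>
     reduced u \<and> reduced v \<and> (u \<noteq> [] \<longrightarrow> v \<noteq> [] \<longrightarrow> hd v \<noteq> inv_letter (last u))"
  by (auto simp: reduced_def successively_append_iff)

lemma reduced_Cons: "reduced (a # w) \<longleftrightarrow> reduced w \<and> (w \<noteq> [] \<longrightarrow> hd w \<noteq> inv_letter a)"
  by (auto simp: reduced_def successively_Cons)

lemma reduced_inverse_word [simp]: "reduced (inverse_word w) \<longleftrightarrow> reduced w"
proof -
  have "reduced (inverse_word w)" if "reduced w" for w :: "'b letter list"
    using that
      by (induction w) (auto simp: reduced_Cons reduced_append inverse_word_def last_rev last_map hd_map)
  from this[of w] this[of "inverse_word w"] show ?thesis by auto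
qed

lemma free_eq_refl [simp, intro]: "u \<simeq> u"
  by (simp add: free_eq_def)

lemma free_eq_sym: "u \<simeq> v \<Longrightarrow> v \<simeq> u"
  by (simp add: free_eq_def)

lemma free_eq_trans [trans]: "u \<simeq> v \<Longrightarrow> v \<simeq> w \<Longrightarrow> u \<simeq> w"
  by (simp add: free_eq_def)

lemma free_eq_append: "u \<simeq> u' \<Longrightarrow> v \<simeq> v' \<Longrightarrow> u @ v \<simeq> u' @ v'"
  unfolding free_eq_def by (metis reduce_append_reduce_left reduce_append_reduce_right)

lemma free_eq_reduce [simp]: "reduce u \<simeq> u" "u \<simeq> reduce u"
  by (simp_all add: free_eq_def reduce_reduced reduced_reduce)

lemma free_eq_reduced: "u \<simeq> v \<Longrightarrow> reduced u \<Longrightarrow> reduced v \<Longrightarrow> u = v"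
  by (simp add: free_eq_def reduce_reduced)

lemma inverse_word_right: "w @ inverse_word w \<simeq> []"
  using reduce_inverse[of "inverse_word w"]
    by (simp add: free_eq_def flip: inverse_word_def) (simp add: reduce_def)

lemma inverse_word_left: "inverse_word w @ w \<simeq> []"
  using inverse_word_right[of "inverse_word w"] by simp

lemma free_eq_cancel: "x @ w @ inverse_word w @ y \<simeq> x @ y" "x @ inverse_word w @ w @ y \<simeq> x @ y"
proof -
  show *: "x @ w @ inverse_word w @ y \<simeq> x @ y" for w
    using free_eq_append[OF free_eq_refl[of x] free_eq_append[OF inverse_word_right[of w] free_eq_refl[of y]]] by simp
  show "x @ inverse_word w @ w @ y \<simeq> x @ y"
    using *[of "inverse_word w"] by simp
qed

lemma free_eq_cancel_letter: "x @ a # inv_letter a # y \<simeq> x @ y" "x @ inv_letter a # a # y \<simeq> x @ y"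
  using free_eq_cancel[of x "[a]" y] by simp_all

lemma free_eq_move_left: "g @ u \<simeq> v \<longleftrightarrow> u \<simeq> inverse_word g @ v"
proof
  assume "g @ u \<simeq> v"
  then have "inverse_word g @ g @ u \<simeq> inverse_word g @ v" by (intro free_eq_append) auto
  then show "u \<simeq> inverse_word g @ v"
    using free_eq_cancel(2)[of "[]" g u] by (auto intro: free_eq_trans free_eq_sym)
next
  assume "u \<simeq> inverse_word g @ v"
  then have "g @ u \<simeq> g @ inverse_word g @ v" by (intro free_eq_append) auto
  then show "g @ u \<simeq> v" using free_eq_cancel(1)[of "[]" g v] by (auto intro: free_eq_trans)
qed

lemma free_eq_move_right: "u @ g \<simeq> v \<longleftrightarrow> u \<simeq> v @ inverse_word g"
proof
  assume "u @ g \<simeq> v"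
  then have "(u @ g) @ inverse_word g \<simeq> v @ inverse_word g" by (intro free_eq_append) auto
  then show "u \<simeq> v @ inverse_word g"
    using free_eq_cancel(1)[of u g "[]"] by (auto intro: free_eq_trans free_eq_sym)
next
  assume "u \<simeq> v @ inverse_word g"
  then have "u @ g \<simeq> (v @ inverse_word g) @ g" by (intro free_eq_append) auto
  then show "u @ g \<simeq> v" using free_eq_cancel(2)[of v g "[]"] by (auto intro: free_eq_trans)
qed

lemma free_eq_inverse_word: "u \<simeq> v \<Longrightarrow> inverse_word u \<simeq> inverse_word v"
proof -
  assume *: "u \<simeq> v"
  have "inverse_word u @ u \<simeq> inverse_word u @ v" using * by (intro free_eq_append) auto
  with inverse_word_left[of u] have "inverse_word u @ v \<simeq> []" by (metis free_eq_sym free_eq_trans)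
  then show ?thesis by (simp add: free_eq_move_right)
qed

lemma free_eq_imp_conj: "u \<simeq> v \<Longrightarrow> u \<sim> v"
  unfolding conjugate_def by (rule exI[of _ "[]"]) simp

lemma conjugate_refl [simp, intro]: "u \<sim> u"
  by (simp add: free_eq_imp_conj)

lemma wconjI: "u \<simeq> g @ v @ inverse_word g \<Longrightarrow> u \<sim> v"
  unfolding conjugate_def by blast

lemma conjugate_sym: "u \<sim> v \<Longrightarrow> v \<sim> u"
proof -
  assume "u \<sim> v"
  then obtain g where "u \<simeq> g @ v @ inverse_word g" by (auto simp: conjugate_def)
  then have "g @ v @ inverse_word g \<simeq> u" by (rule free_eq_sym)
  then have "v @ inverse_word g \<simeq> inverse_word g @ u" by (simp only: free_eq_move_left)
  then have "v \<simeq> inverse_word g @ u @ inverse_word (inverse_word g)"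
    using free_eq_move_right[of v "inverse_word g" "inverse_word g @ u"] by simp
  then show ?thesis by (rule wconjI)
qed

lemma conjugate_trans [trans]: "u \<sim> v \<Longrightarrow> v \<sim> w \<Longrightarrow> u \<sim> w"
proof -
  assume "u \<sim> v" "v \<sim> w"
  then obtain g h where g: "u \<simeq> g @ v @ inverse_word g" and h: "v \<simeq> h @ w @ inverse_word h"
    by (auto simp: conjugate_def)
  have "g @ v @ inverse_word g \<simeq> g @ (h @ w @ inverse_word h) @ inverse_word g"
    by (intro free_eq_append h) auto
  with g have "u \<simeq> (g @ h) @ w @ inverse_word (g @ h)" by (auto intro: free_eq_trans)
  then show ?thesis by (rule wconjI)
qed

lemma conjugate_free_eq_trans [trans]: "u \<sim> v \<Longrightarrow> v \<simeq> w \<Longrightarrow> u \<sim> w" "u \<simeq> v \<Longrightarrow> v \<sim> w \<Longrightarrow> u \<sim> w"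
  by (blast intro: conjugate_trans free_eq_imp_conj)+

lemma conjugate_swap: "u @ v \<sim> v @ u"
proof (rule wconjI)
  show "u @ v \<simeq> u @ (v @ u) @ inverse_word u"
    using free_eq_sym[OF free_eq_cancel(1)[of "u @ v" u "[]"]] by simp
qed

lemma conjugate_rotate: "rotate n w \<sim> w"
  by (metis append_take_drop_id rotate_drop_take conjugate_swap)

lemma conjugate_Nil: "u \<sim> [] \<longleftrightarrow> u \<simeq> []"
proof
  assume "u \<sim> []"
  then obtain g where "u \<simeq> g @ inverse_word g" by (auto simp: conjugate_def)
  with inverse_word_right[of g] show "u \<simeq> []" by (rule free_eq_trans[rotated])
qed (rule free_eq_imp_conj)

section \<open>Cyclically reduced words\<close>

definition cyclically_reduced :: "'b letter list \<Rightarrow> bool" where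
  "cyclically_reduced w \<longleftrightarrow> reduced (w @ take 1 w)"

lemma cyclically_reduced_reduced: "cyclically_reduced w \<Longrightarrow> reduced w"
  by (simp add: cyclically_reduced_def reduced_append)

text \<open>
  In this form the definition says that there is no cancellation between the two ends. The
  definition itself repeats the first letter at the end, so that cyclic adjacency in \<open>w\<close> becomes
  ordinary adjacency.
\<close>

lemma cyclically_reduced_iff: "cyclically_reduced w \<longleftrightarrow> reduced w \<and> (w \<noteq> [] \<longrightarrow> hd w \<noteq> inv_letter (last w))"
  by (cases w) (auto simp: cyclically_reduced_def reduced_append reduced_Cons)

lemma cyclically_reduced_rotate1 [simp]: "cyclically_reduced (rotate1 w) \<longleftrightarrow> cyclically_reduced w"
  by (cases w) (auto simp: cyclically_reduced_iff reduced_append reduced_Cons)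

lemma cyclically_reduced_rotate [simp]: "cyclically_reduced (rotate n w) \<longleftrightarrow> cyclically_reduced w"
  by (induction n) auto

lemma length_reduce_le: "length (reduce w) \<le> length w"
proof (induction w)
  case (Cons a w)
  have "length (push a v) \<le> Suc (length v)" for v by (cases v) auto
  from this[of "reduce w"] Cons show ?case by (simp add: reduce_def)
qed (simp add: reduce_def)

lemma cyclic_reduction_exists: "\<exists>w'. cyclically_reduced w' \<and> w' \<sim> w"
proof (induction "length w" arbitrary: w rule: less_induct)
  case less
  show ?case
  proof (cases "cyclically_reduced (reduce w)")
    case True
    then show ?thesis by (meson free_eq_imp_conj free_eq_reduce(1))
  next
    case False
    then obtain a m where am: "reduce w = a # m"
      by (cases "reduce w") (auto simp: cyclically_reduced_def)
    from False have "inv_letter (last (a # m)) = a"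
      using reduced_reduce[of w] by (auto simp: cyclically_reduced_iff am)
    then obtain n where n: "m = n @ [inv_letter a]"
      by (metis append_butlast_last_id inv_letter_invol inv_letter_neq(1) last.simps)
    have "length n < length w" using length_reduce_le[of w] am n by simp
    from less[OF this] obtain w' where "cyclically_reduced w'" "w' \<sim> n" by blast
    moreover have "n \<sim> reduce w" by (rule conjugate_sym, rule wconjI[of _ "[a]"]) (simp add: am n)
    ultimately show ?thesis by (meson conjugate_free_eq_trans free_eq_reduce conjugate_trans)
  qed
qed

text \<open>
  Peel the conjugating word from the inside. Conjugating a cyclically reduced word by one letter
  either rotates it or produces no cancellation; in the latter case the remaining letters of the
  reduced conjugating word cannot cancel either, and the result is strictly longer.
\<close>

lemma cyclically_reduced_conjugate_by:
  assumes "cyclically_reduced w" "reduced g" "reduced v" "v \<simeq> g @ w @ inverse_word g"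
  shows "length w < length v \<or> (\<exists>i. v = rotate i w)"
  using assms
proof (induction g arbitrary: w rule: rev_induct)
  case Nil
  then have "v = w" using free_eq_reduced[of v w] cyclically_reduced_reduced[of w] by simp
  then show ?case by (intro disjI2 exI[of _ 0]) simp
next
  case (snoc x g)
  have g: "reduced g" using snoc.prems by (simp add: reduced_append)
  consider "w = []" | m where "w = inv_letter x # m" | m where "w = m @ [x]"
    | "w \<noteq> []" "hd w \<noteq> inv_letter x" "last w \<noteq> x"
    by (metis append_butlast_last_id list.collapse)
  then show ?case
  proof cases
    case 1
    with snoc.prems(4) have "v \<simeq> (g @ [x]) @ inverse_word (g @ [x])" by simp
    then have "v \<simeq> []" using inverse_word_right by (rule free_eq_trans)
    with snoc.prems have "v = []" using free_eq_reduced[of v "[]"] by simp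
    with 1 show ?thesis by simp
  next
    case (2 m)
    have "v \<simeq> g @ rotate1 w @ inverse_word g"
      using free_eq_trans[OF snoc.prems(4)] free_eq_cancel_letter(1)[of g x "m
        @ inv_letter x # inverse_word g"] 2 by simp
    from snoc.IH[OF _ g _ this] snoc.prems obtain i where "length w < length v \<or> v = rotate i (rotate1 w)"
      by auto
    then show ?thesis by (metis rotate_Suc rotate1_rotate_swap)
  next
    case (3 m)
    have *: "v \<simeq> g @ (x # m) @ inverse_word g"
      using free_eq_trans[OF snoc.prems(4)] free_eq_cancel_letter(1)[of "g
        @ x # m" x "inverse_word g"] 3 by simp
    have rot: "x # m = rotate (length m) w"
      using rotate_append[of m "[x]"] 3 by simp
    have "cyclically_reduced (x # m)" using snoc.prems rot by simp
    from snoc.IH[OF this g _ *] snoc.prems obtain i where "length (x # m) < length v \<or> v = rotate i (x # m)"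
      by auto
    then show ?thesis using rot by (metis rotate_rotate length_rotate)
  next
    case 4
    have "reduced (inverse_word (g @ [x]))" using snoc.prems(2) by (simp only: reduced_inverse_word)
    moreover have "hd (inverse_word (g @ [x])) \<noteq> inv_letter (last w)" using 4 by auto
    ultimately have "reduced (w @ inverse_word (g @ [x]))"
      using snoc.prems(1) by (simp only: reduced_append cyclically_reduced_reduced) blast
    moreover have "hd (w @ inverse_word (g @ [x])) \<noteq> inv_letter (last (g @ [x]))"
      using 4 by simp
    ultimately have "reduced ((g @ [x]) @ w @ inverse_word (g @ [x]))"
      using snoc.prems(2)
        unfolding reduced_append[of "g @ [x]" "w @ inverse_word (g @ [x])"] by blast
    with snoc.prems have "v = (g @ [x]) @ w @ inverse_word (g @ [x])"
      using free_eq_reduced[of v "(g @ [x]) @ w @ inverse_word (g @ [x])"] by blast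
    then show ?thesis by simp
  qed
qed

lemma cyclically_reduced_conjugate:
  assumes "cyclically_reduced w" "v \<sim> w" "reduced v"
  shows "length w < length v \<or> (\<exists>i. v = rotate i w)"
proof -
  obtain g where g: "v \<simeq> g @ w @ inverse_word g" using assms by (auto simp: conjugate_def)
  have "g @ w @ inverse_word g \<simeq> reduce g @ w @ inverse_word (reduce g)"
    by (intro free_eq_append free_eq_inverse_word) auto
  with g have "v \<simeq> reduce g @ w @ inverse_word (reduce g)" by (rule free_eq_trans)
  with assms show ?thesis by (intro cyclically_reduced_conjugate_by) (auto simp: reduced_reduce)
qed

text \<open>
  The least length in the conjugacy class. It is defined through an arbitrary cyclically reduced
  representative; \<open>cyclic_length_eq\<close> shows that the choice does not matter.
\<close>

definition cyclic_length :: "'b letter list \<Rightarrow> nat" where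
  "cyclic_length w = length (SOME w'. cyclically_reduced w' \<and> w' \<sim> w)"

lemma cyclic_length_eq: "cyclically_reduced w' \<Longrightarrow> w' \<sim> w \<Longrightarrow> cyclic_length w = length w'"
proof -
  assume w': "cyclically_reduced w'" "w' \<sim> w"
  define v where "v = (SOME w'. cyclically_reduced w' \<and> w' \<sim> w)"
  have v: "cyclically_reduced v" "v \<sim> w"
    using someI_ex[OF cyclic_reduction_exists[of w]] by (auto simp: v_def)
  have vw: "v \<sim> w'" "w' \<sim> v" using v w' by (meson conjugate_sym conjugate_trans)+
  have "length w' \<le> length v" "length v \<le> length w'"
    using cyclically_reduced_conjugate[OF w'(1) vw(1) cyclically_reduced_reduced[OF v(1)]]
      cyclically_reduced_conjugate[OF v(1) vw(2) cyclically_reduced_reduced[OF w'(1)]] by auto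
  then show ?thesis by (simp add: cyclic_length_def flip: v_def)
qed

lemma cyclic_length_cyclically_reduced: "cyclically_reduced w \<Longrightarrow> cyclic_length w = length w"
  by (auto intro: cyclic_length_eq)

lemma cyclic_length_conj: "u \<sim> v \<Longrightarrow> cyclic_length u = cyclic_length v"
  by (metis cyclic_length_eq cyclic_reduction_exists conjugate_trans)

lemma cyclic_length_le: "reduced v \<Longrightarrow> cyclic_length v \<le> length v"
  by (metis cyclic_length_eq cyclic_reduction_exists cyclically_reduced_conjugate
      length_rotate nat_less_le order_refl conjugate_sym)

lemma cyclically_reduced_if_cyclic_length: "reduced v \<Longrightarrow> cyclic_length v = length v \<Longrightarrow> cyclically_reduced v"
  by (metis cyclic_length_eq cyclic_reduction_exists cyclically_reduced_conjugate
      cyclically_reduced_rotate nat_less_le conjugate_sym)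

section \<open>Substitutions\<close>

text \<open>
  Endomorphisms are represented by the images of all letters, inverse letters included; a family
  of images represents one if it is \<open>equivariant\<close>.
\<close>

definition substitute :: "('b letter \<Rightarrow> 'c letter list) \<Rightarrow> 'b letter list \<Rightarrow> 'c letter list" where
  "substitute F w = concat (map F w)"

definition equivariant :: "('b letter \<Rightarrow> 'c letter list) \<Rightarrow> bool" where
  "equivariant F \<longleftrightarrow> (\<forall>x. F (inv_letter x) = inverse_word (F x))"

lemma substitute_simps [simp]:
  "substitute F [] = []" "substitute F (x # w) = F x @ substitute F w"
    "substitute F (u @ v) = substitute F u @ substitute F v"
  by (simp_all add: substitute_def)

lemma substitute_substitute: "substitute F (substitute G w) = substitute (\<lambda>x. substitute F (G x)) w"
  by (induction w) auto

lemma substitute_single [simp]: "substitute (\<lambda>x. [m x]) w = map m w"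
  by (induction w) auto

lemma substitute_id: "(\<And>x. x \<in> set w \<Longrightarrow> F x = [x]) \<Longrightarrow> substitute F w = w"
  by (induction w) auto

lemma substitute_inverse_word:
  "equivariant F \<Longrightarrow> substitute F (inverse_word w) = inverse_word (substitute F w)"
  by (induction w) (auto simp: equivariant_def)

lemma substitute_reduce: "equivariant F \<Longrightarrow> substitute F (reduce w) \<simeq> substitute F w"
proof (induction w)
  case (Cons a w)
  have push: "substitute F (push a v) \<simeq> F a @ substitute F v" for v
  proof (cases v)
    case (Cons b v')
    show ?thesis
    proof (cases "b = inv_letter a")
      case True
      then have "F b = inverse_word (F a)" using \<open>equivariant F\<close> unfolding equivariant_def by blast
      with True Cons show ?thesis
        using free_eq_sym[OF free_eq_cancel(1)[of "[]" "F a" "substitute F v'"]] by simp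
    qed (use Cons in simp)
  qed simp
  have "substitute F (reduce (a # w)) \<simeq> F a @ substitute F (reduce w)"
    using push[of "reduce w"] by (simp add: reduce_def)
  also have "F a @ substitute F (reduce w) \<simeq> F a @ substitute F w"
    using Cons by (intro free_eq_append) auto
  finally show ?case by simp
qed (simp add: reduce_def)

lemma substitute_free_eq: "equivariant F \<Longrightarrow> u \<simeq> v \<Longrightarrow> substitute F u \<simeq> substitute F v"
  by (metis substitute_reduce free_eq_def)

lemma substitute_conjugate:
  assumes "equivariant F" "u \<sim> v"
  shows "substitute F u \<sim> substitute F v"
proof -
  obtain g where "u \<simeq> g @ v @ inverse_word g" using assms by (auto simp: conjugate_def)
  then have "substitute F u \<simeq> substitute F g @ substitute F v @ inverse_word (substitute F g)"
    using substitute_free_eq[OF assms(1)] substitute_inverse_word[OF assms(1)] by fastforce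
  then show ?thesis by (rule wconjI)
qed

text \<open>
  Two endomorphisms that differ by an inner automorphism on the letters differ by it everywhere;
  the relations between twists and signed permutations below are all verified in this way.
\<close>

lemma substitute_conjugated:
  assumes "\<And>x. F x \<simeq> g @ F' x @ inverse_word g"
  shows "substitute F w \<simeq> g @ substitute F' w @ inverse_word g"
proof (induction w)
  case Nil
  show ?case using free_eq_sym[OF inverse_word_right[of g]] by simp
next
  case (Cons x w)
  have "substitute F (x # w) \<simeq> (g @ F' x @ inverse_word g) @ (g @ substitute F' w @ inverse_word g)"
    using free_eq_append[OF assms Cons] by simp
  also have "\<dots> \<simeq> g @ substitute F' (x # w) @ inverse_word g"
    using free_eq_cancel(2)[of "g @ F' x" g] by simp
  finally show ?case .
qed

lemma substitute_conjugated_conjugate: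
  "(\<And>x. F x \<simeq> g @ F' x @ inverse_word g) \<Longrightarrow> substitute F w \<sim> substitute F' w"
  by (rule wconjI, rule substitute_conjugated)

lemma substitute_free_eq_letters: "(\<And>x. F x \<simeq> F' x) \<Longrightarrow> substitute F w \<simeq> substitute F' w"
  by (induction w) (auto intro: free_eq_append)

section \<open>Twists\<close>

fun other :: "gen2 \<Rightarrow> gen2" where
  "other GenA = GenB"
| "other GenB = GenA"

lemma other_simps [simp]: "other (other g) = g" "other g \<noteq> g" "g \<noteq> other g"
  by (cases g; simp)+

lemma neq_iff_other: "h \<noteq> g \<longleftrightarrow> h = other g"
  by (cases g; cases h; simp)

definition gen_power :: "'b \<Rightarrow> int \<Rightarrow> 'b letter list" where
  "gen_power x k = replicate (nat \<bar>k\<bar>) (x, k > 0)"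

lemma gen_power_0 [simp]: "gen_power x 0 = []" and gen_power_1 [simp]: "gen_power x 1 = [(x, True)]"
  and gen_power_m1 [simp]: "gen_power x (-1) = [(x, False)]"
  by (simp_all add: gen_power_def)

lemma length_gen_power [simp]: "length (gen_power x k) = nat \<bar>k\<bar>"
  by (simp add: gen_power_def)

lemma inverse_word_gen_power [simp]: "inverse_word (gen_power x k) = gen_power x (- k)"
  by (auto simp: gen_power_def inverse_word_def)

lemma gen_power_Suc: "k \<ge> 0 \<Longrightarrow> gen_power x (k + 1) = (x, True) # gen_power x k"
  and gen_power_pred: "k \<le> 0 \<Longrightarrow> gen_power x (k - 1) = (x, False) # gen_power x k"
proof -
  assume "k \<ge> 0"
  then have "nat \<bar>k + 1\<bar> = Suc (nat \<bar>k\<bar>)" by simp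
  then show "gen_power x (k + 1) = (x, True) # gen_power x k" using \<open>k \<ge> 0\<close>
    by (cases "k = 0") (simp_all add: gen_power_def)
next
  assume "k \<le> 0"
  then have "nat \<bar>k - 1\<bar> = Suc (nat \<bar>k\<bar>)" by simp
  then show "gen_power x (k - 1) = (x, False) # gen_power x k" using \<open>k \<le> 0\<close> by (simp add: gen_power_def)
qed

lemma gen_power_Suc_free_eq: "gen_power x (k + 1) \<simeq> (x, True) # gen_power x k"
proof (cases "k \<ge> 0")
  case False
  then have "gen_power x k = (x, False) # gen_power x (k + 1)"
    using gen_power_pred[of "k + 1" x] by simp
  then show ?thesis
    using free_eq_sym[OF free_eq_cancel_letter(1)[of "[]" "(x, True)" "gen_power x (k + 1)"]]
      by simp
qed (simp add: gen_power_Suc)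

lemma gen_power_pred_free_eq: "gen_power x (k - 1) \<simeq> (x, False) # gen_power x k"
proof (cases "k \<le> 0")
  case False
  then have "gen_power x k = (x, True) # gen_power x (k - 1)"
    using gen_power_Suc[of "k - 1" x] by simp
  then show ?thesis
    using free_eq_sym[OF free_eq_cancel_letter(1)[of "[]" "(x, False)" "gen_power x (k - 1)"]]
      by simp
qed (simp add: gen_power_pred)

lemma gen_power_add: "gen_power x j @ gen_power x k \<simeq> gen_power x (j + k)"
proof (induction j rule: int_induct[where k = 0])
  case (step1 j)
  have "gen_power x (j + 1) @ gen_power x k \<simeq> ((x, True) # gen_power x j) @ gen_power x k"
    by (intro free_eq_append gen_power_Suc_free_eq) simp
  also have "\<dots> = [(x, True)] @ gen_power x j @ gen_power x k" by simp
  also have "\<dots> \<simeq> [(x, True)] @ gen_power x (j + k)"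
    using step1 by (intro free_eq_append) auto
  also have "\<dots> \<simeq> gen_power x (j + 1 + k)"
    using free_eq_sym[OF gen_power_Suc_free_eq[of x "j + k"]] by (simp add: algebra_simps)
  finally show ?case .
next
  case (step2 j)
  have "gen_power x (j - 1) @ gen_power x k \<simeq> ((x, False) # gen_power x j) @ gen_power x k"
    by (intro free_eq_append gen_power_pred_free_eq) simp
  also have "\<dots> = [(x, False)] @ gen_power x j @ gen_power x k" by simp
  also have "\<dots> \<simeq> [(x, False)] @ gen_power x (j + k)"
    using step2 by (intro free_eq_append) auto
  also have "\<dots> \<simeq> gen_power x (j - 1 + k)"
    using free_eq_sym[OF gen_power_pred_free_eq[of x "j + k"]] by (simp add: algebra_simps)
  finally show ?case .
qed simp

fun twist :: "gen2 \<Rightarrow> int \<Rightarrow> gen2 letter \<Rightarrow> gen2 letter list" where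
  "twist g m (h, e) =
     (if h \<noteq> g then [(h, e)] else if e then (g, True) # gen_power (other g) m
      else gen_power (other g) (- m) @ [(g, False)])"

lemma equivariant_twist [simp, intro]: "equivariant (twist g m)"
  by (auto simp: equivariant_def)

lemma substitute_twist_gen_power [simp]: "h \<noteq> g \<Longrightarrow> substitute (twist g m) (gen_power h k) = gen_power h k"
  by (rule substitute_id) (auto simp: gen_power_def)

lemma twist_twist: "substitute (twist g m) (substitute (twist g n) w) \<simeq> substitute (twist g (m + n)) w"
  unfolding substitute_substitute
proof (rule substitute_free_eq_letters)
  fix x
  show "substitute (twist g m) (twist g n x) \<simeq> twist g (m + n) x"
    using free_eq_append[OF free_eq_refl[of "[(g, True)]"] gen_power_add[of "other g" m n]]
      free_eq_append[OF gen_power_add[of "other g" "- n" "- m"] free_eq_refl[of "[(g, False)]"]]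
    by (cases x) (auto simp: algebra_simps)
qed

lemma twist_0 [simp]: "substitute (twist g 0) w = w"
  by (rule substitute_id) auto

section \<open>The length of a twisted cyclic word\<close>

fun path_sum :: "('a \<Rightarrow> 'a \<Rightarrow> int) \<Rightarrow> 'a list \<Rightarrow> int" where
  "path_sum h (x # y # w) = h x y + path_sum h (y # w)"
| "path_sum h _ = 0"

text \<open>
  The repeated first letter closes up the cycle.
\<close>

definition cyclic_sum :: "('a \<Rightarrow> 'a \<Rightarrow> int) \<Rightarrow> 'a list \<Rightarrow> int" where
  "cyclic_sum h w = path_sum h (w @ take 1 w)"

lemma path_sum_append: "path_sum h (u @ x # v) = path_sum h (u @ [x]) + path_sum h (x # v)"
  by (induction h u rule: path_sum.induct) auto

lemma cyclic_sum_rotate1: "cyclic_sum h (rotate1 w) = cyclic_sum h w"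
proof (cases w)
  case (Cons x v)
  then show ?thesis
    using path_sum_append[of h v x "take 1 v"]
    by (cases v) (auto simp: cyclic_sum_def)
qed simp

lemma cyclic_sum_rotate: "cyclic_sum h (rotate n w) = cyclic_sum h w"
  by (induction n) (auto simp: cyclic_sum_rotate1)

lemma path_sum_replicate:
  "path_sum h (x # replicate n y @ z # r) =
     (if n = 0 then h x z else h x y + (int n - 1) * h y y + h y z) + path_sum h (z # r)"
  by (induction n arbitrary: x) (auto simp: algebra_simps)

lemma path_sum_gen_power:
  "path_sum h (x # gen_power c k @ z # r) =
     (if k = 0 then h x z
      else h x (c, k > 0) + (\<bar>k\<bar> - 1) * h (c, k > 0) (c, k > 0) + h (c, k > 0) z) + path_sum h (z # r)"
  by (simp add: gen_power_def path_sum_replicate)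

lemma path_sum_zero: "(\<And>x y. x \<in> set w \<Longrightarrow> y \<in> set w \<Longrightarrow> h x y = 0) \<Longrightarrow> path_sum h w = 0"
  by (induction h w rule: path_sum.induct) auto

lemma path_sum_nonneg: "(\<And>x y. h x y \<ge> 0) \<Longrightarrow> path_sum h w \<ge> 0"
  by (induction h w rule: path_sum.induct) auto

definition repeats :: "'b \<Rightarrow> 'b letter list \<Rightarrow> int" where
  "repeats g = cyclic_sum (\<lambda>x y. if fst x = g \<and> fst y = g then 1 else 0)"

definition balance :: "'b letter list \<Rightarrow> int" where
  "balance = cyclic_sum (\<lambda>x y. if fst x = fst y then 0 else if snd x = snd y then 1 else -1)"

lemma repeats_nonneg: "repeats g w \<ge> 0"
  by (simp add: repeats_def cyclic_sum_def path_sum_nonneg)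

text \<open>
  Relative to a generator \<open>g\<close>, the syllable \<open>(d, k)\<close> stands for \<open>g\<close> or its inverse, according to
  \<open>d\<close>, followed by the gap \<open>o\<^sup>k\<close>. A list of syllables is read cyclically; in the functions on
  linear lists, the argument \<open>e\<close> is the sign of the syllable that follows the last one, which
  allows induction on the list.
\<close>

fun syllable_word :: "gen2 \<Rightarrow> (bool \<times> int) list \<Rightarrow> gen2 letter list" where
  "syllable_word g [] = []"
| "syllable_word g ((d, k) # l) = (g, d) # gen_power (other g) k @ syllable_word g l"

fun next_sign :: "bool \<Rightarrow> (bool \<times> int) list \<Rightarrow> bool" where
  "next_sign e [] = e"
| "next_sign e ((d, k) # l) = d"

text \<open>
  The substitution \<open>twist g m\<close> puts \<open>o\<^sup>m\<close> behind every \<open>g\<close> and \<open>o\<close> to the power \<open>-m\<close> in front of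
  every inverse of \<open>g\<close>. Hence the gap between letters of signs \<open>d\<close> and \<open>e\<close> grows by \<open>m * gap_shift
  d e\<close>.
\<close>

definition gap_shift :: "bool \<Rightarrow> bool \<Rightarrow> int" where
  "gap_shift d e = (if d then 1 else 0) - (if e then 0 else 1)"

fun twist_syllables :: "int \<Rightarrow> bool \<Rightarrow> (bool \<times> int) list \<Rightarrow> (bool \<times> int) list" where
  "twist_syllables m e [] = []"
| "twist_syllables m e ((d, k) # l) = (d, k + m * gap_shift d (next_sign e l)) # twist_syllables m e l"

text \<open>
  The only possible cancellation is across an empty gap.
\<close>

fun reduced_syllables :: "bool \<Rightarrow> (bool \<times> int) list \<Rightarrow> bool" where
  "reduced_syllables e [] \<longleftrightarrow> True"
| "reduced_syllables e ((d, k) # l) \<longleftrightarrow> (k = 0 \<longrightarrow> d = next_sign e l) \<and> reduced_syllables e l"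

lemma next_sign_twist_syllables [simp]: "next_sign e (twist_syllables m e l) = next_sign e l"
  by (cases l) auto

text \<open>
  A gap between letters of different signs is never shifted, so a twist creates no cancellation.
\<close>

lemma reduced_syllables_twist_syllables:
  "reduced_syllables e l \<Longrightarrow> reduced_syllables e (twist_syllables m e l)"
  by (induction l) (auto simp: gap_shift_def split: if_splits)

lemma closed_syllable_word_Cons: "\<exists>r. syllable_word g l @ [(g, e)] = (g, next_sign e l) # r"
  by (cases l) auto

lemma reduced_replicate: "reduced (replicate n x)"
  by (induction n) (auto simp: reduced_Cons)

lemma reduced_syllable:
  assumes "c \<noteq> g"
  shows "reduced ((g, d) # gen_power c k @ (g, d') # r) \<longleftrightarrow> (k = 0 \<longrightarrow> d = d') \<and> reduced ((g, d') # r)"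
proof (cases "k = 0")
  case False
  then obtain n where "gen_power c k = replicate (Suc n) (c, k > 0)"
    unfolding gen_power_def by (metis abs_eq_0 not0_implies_Suc nat_0_iff abs_le_zero_iff)
  moreover have "reduced (replicate (Suc n) (c, k > 0))" by (rule reduced_replicate)
  ultimately show ?thesis using assms False
    by (simp only: reduced_Cons[of "(g, d)"] reduced_append) auto
qed (auto simp: reduced_Cons)

lemma reduced_syllable_word: "reduced (syllable_word g l @ [(g, e)]) \<longleftrightarrow> reduced_syllables e l"
proof (induction l)
  case (Cons s l)
  obtain d k where s: "s = (d, k)" by (cases s)
  obtain r where r: "syllable_word g l @ [(g, e)] = (g, next_sign e l) # r"
    using closed_syllable_word_Cons by blast
  show ?case using Cons reduced_syllable[of "other g" g d k "next_sign e l" r] by (simp add: s r)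
qed (simp add: reduced_Cons)

lemma cyclically_reduced_syllable_word:
  "l \<noteq> [] \<Longrightarrow> cyclically_reduced (syllable_word g l) \<longleftrightarrow> reduced_syllables (fst (hd l)) l"
  using reduced_syllable_word[of g l "fst (hd l)"] by (cases l) (auto simp: cyclically_reduced_def)

text \<open>
  Gap by gap: a shift of an empty gap by \<open>s\<close> adds one letter and is seen by \<open>repeats\<close>; a nonempty
  gap becomes longer or shorter according to its sign, and the two pairs at its ends contribute
  the corresponding value, or cancel each other if the gap is not shifted, to the balance.
\<close>

lemma length_syllable_word_twist_syllables:
  assumes "reduced_syllables e l" "s \<in> {1, -1}"
  shows "2 * int (length (syllable_word g (twist_syllables s e l))) = 2 * int (length (syllable_word g l))
    + 2 * path_sum (\<lambda>x y. if fst x = g \<and> fst y = g then 1 else 0) (syllable_word g l @ [(g, e)])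
    + s * path_sum (\<lambda>x y. if fst x = fst y then 0 else if snd x = snd y then 1 else -1)
      (syllable_word g l @ [(g, e)])"
  using assms(1)
proof (induction l)
  case (Cons t l)
  obtain d k where t: "t = (d, k)" by (cases t)
  obtain r where r: "syllable_word g l @ [(g, e)] = (g, next_sign e l) # r"
    using closed_syllable_word_Cons by blast
  have IH: "2 * int (length (syllable_word g (twist_syllables s e l)))
    = 2 * int (length (syllable_word g l))
    + 2 * path_sum (\<lambda>x y. if fst x = g \<and> fst y = g then 1 else 0) ((g, next_sign e l) # r)
    + s * path_sum (\<lambda>x y. if fst x = fst y then 0 else if snd x = snd y then 1 else -1)
      ((g, next_sign e l) # r)"
    using Cons by (simp add: t r)
  have gap: "k = 0 \<Longrightarrow> d = next_sign e l" using Cons.prems by (simp add: t)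
  show ?case
    using IH gap assms(2) unfolding t
    by (cases d; cases "next_sign e l"; cases "k = 0"; cases "k > 0")
       (auto simp: r path_sum_gen_power gap_shift_def algebra_simps)
qed simp

text \<open>
  The letters that a twist puts in front of a syllable with sign \<open>d\<close>, hence into the preceding
  gap.
\<close>

definition correction :: "gen2 \<Rightarrow> int \<Rightarrow> bool \<Rightarrow> gen2 letter list" where
  "correction g m d = gen_power (other g) (if d then 0 else - m)"

text \<open>
  The correction is carried from one end of the list to the other. In a cyclic list both
  corrections agree, which makes the twisted word a conjugate of the shifted syllables.
\<close>

lemma twist_syllable_word_open:
  "substitute (twist g m) (syllable_word g l) @ correction g m e
    \<simeq> correction g m (next_sign e l) @ syllable_word g (twist_syllables m e l)"
proof (induction l)
  case (Cons t l)
  obtain d k where t: "t = (d, k)" by (cases t)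
  let ?o = "other g"
  have 1: "gen_power ?o i @ gen_power ?o k @ gen_power ?o j \<simeq> gen_power ?o (i + k + j)" for i j
    using free_eq_trans[OF free_eq_append[OF free_eq_refl gen_power_add] gen_power_add]
      by (simp add: add.assoc)
  have "substitute (twist g m) (syllable_word g (t # l)) @ correction g m e
      = twist g m (g, d) @ gen_power ?o k @ (substitute (twist g m) (syllable_word g l) @ correction g m e)"
    by (simp add: t del: twist.simps)
  also have "\<dots>
    \<simeq> twist g m (g, d) @ gen_power ?o k @ (correction g m (next_sign e l)
      @ syllable_word g (twist_syllables m e l))"
    by (intro free_eq_append Cons free_eq_refl)
  also have "\<dots>
    \<simeq> correction g m d @ (g, d) # gen_power ?o (k + m * gap_shift d (next_sign e l))
      @ syllable_word g (twist_syllables m e l)"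
  proof -
    let ?i = "if d then m else 0" and ?j = "if next_sign e l then 0 else - m"
    have "twist g m (g, d) @ gen_power ?o k @ correction g m (next_sign e l)
      = (correction g m d @ [(g, d)]) @ gen_power ?o ?i @ gen_power ?o k @ gen_power ?o ?j"
      by (auto simp: correction_def)
    also have "\<dots> \<simeq> (correction g m d @ [(g, d)]) @ gen_power ?o (?i + k + ?j)"
      by (intro free_eq_append 1 free_eq_refl)
    also have "?i + k + ?j = k + m * gap_shift d (next_sign e l)"
      by (auto simp: gap_shift_def algebra_simps)
    finally have "(twist g m (g, d) @ gen_power ?o k @ correction g m (next_sign e l))
      @ syllable_word g (twist_syllables m e l)
      \<simeq> ((correction g m d @ [(g, d)]) @ gen_power ?o (k + m * gap_shift d (next_sign e l)))
        @ syllable_word g (twist_syllables m e l)"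
      by (rule free_eq_append[OF _ free_eq_refl])
    then show ?thesis by (simp only: append_assoc append_Cons append_Nil)
  qed
  finally show ?case by (simp add: t)
qed simp

lemma twist_syllable_word:
  "l \<noteq> [] \<Longrightarrow> substitute (twist g m) (syllable_word g l) \<sim> syllable_word g (twist_syllables m (fst (hd l)) l)"
proof -
  assume "l \<noteq> []"
  then have "next_sign (fst (hd l)) l = fst (hd l)" by (cases l) auto
  with twist_syllable_word_open[of g m l "fst (hd l)"]
  have "substitute (twist g m) (syllable_word g l)
    \<simeq> (correction g m (fst (hd l)) @ syllable_word g (twist_syllables m (fst (hd l)) l))
      @ inverse_word (correction g m (fst (hd l)))"
    unfolding free_eq_move_right by simp
  then show ?thesis by (auto intro: wconjI)
qed

lemma reduced_eq_syllable_word: "reduced w \<Longrightarrow> \<exists>k l. w = gen_power (other g) k @ syllable_word g l"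
proof (induction w)
  case Nil
  show ?case by (rule exI[of _ 0], rule exI[of _ "[]"]) simp
next
  case (Cons x w)
  then obtain k l where w: "w = gen_power (other g) k @ syllable_word g l"
    by (auto simp: reduced_Cons)
  obtain h e where x: "x = (h, e)" by (cases x)
  show ?case
  proof (cases "h = g")
    case True
    then have "x # w = gen_power (other g) 0 @ syllable_word g ((e, k) # l)" by (simp add: x w)
    then show ?thesis by blast
  next
    case False
    then have h: "h = other g" by (simp add: neq_iff_other)
    have hd: "w \<noteq> [] \<Longrightarrow> hd w \<noteq> (h, \<not> e)" using Cons.prems by (simp add: reduced_Cons x)
    have "x # gen_power (other g) k = gen_power (other g) (if e then k + 1 else k - 1)"
    proof (cases e)
      case True
      have "k \<ge> 0"
      proof (rule ccontr)
        assume "\<not> k \<ge> 0"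
        then have "gen_power (other g) k = (h, False) # gen_power (other g) (k + 1)"
          using gen_power_pred[of "k + 1" "other g"] h by simp
        then show False using hd w True by simp
      qed
      then show ?thesis using gen_power_Suc[of k "other g"] True by (simp add: x h)
    next
      case False
      have "k \<le> 0"
      proof (rule ccontr)
        assume "\<not> k \<le> 0"
        then have "gen_power (other g) k = (h, True) # gen_power (other g) (k - 1)"
          using gen_power_Suc[of "k - 1" "other g"] h by simp
        then show False using hd w False by simp
      qed
      then show ?thesis using gen_power_pred[of k "other g"] False by (simp add: x h)
    qed
    then have "x # w = gen_power (other g) (if e then k + 1 else k - 1) @ syllable_word g l"
      by (simp add: w)
    then show ?thesis by blast
  qed
qed

text \<open>
  Rotate the word so that it starts with a letter of the generator \<open>g\<close>; then no gap precedes the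
  first syllable.
\<close>

lemma rotate_eq_syllable_word:
  assumes "cyclically_reduced w" "x \<in> set w" "fst x = g"
  obtains i l where "rotate i w = syllable_word g l" "l \<noteq> []" "reduced_syllables (fst (hd l)) l"
proof -
  obtain u v where w: "w = u @ x # v" using assms(2) by (meson split_list)
  have rot: "rotate (length u) w = x # v @ u" by (simp add: w rotate_append)
  have "cyclically_reduced (rotate (length u) w)" using assms by simp
  from reduced_eq_syllable_word[OF cyclically_reduced_reduced[OF this], of g]
  obtain k l where kl: "rotate (length u) w = gen_power (other g) k @ syllable_word g l" by blast
  have "k = 0"
  proof (rule ccontr)
    assume "k \<noteq> 0"
    then obtain n where "gen_power (other g) k = replicate (Suc n) (other g, k > 0)"
      unfolding gen_power_def by (metis abs_eq_0 not0_implies_Suc nat_0_iff abs_le_zero_iff)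
    with kl rot assms(3) show False by (auto simp: prod_eq_iff)
  qed
  with kl have r: "rotate (length u) w = syllable_word g l" by simp
  moreover have "l \<noteq> []" using r rot by auto
  moreover have "reduced_syllables (fst (hd l)) l"
    using \<open>cyclically_reduced (rotate (length u) w)\<close> \<open>l \<noteq> []\<close> by (simp add: r cyclically_reduced_syllable_word)
  ultimately show thesis using that by blast
qed

lemma twist_no_letter: "(\<And>x. x \<in> set w \<Longrightarrow> fst x \<noteq> g) \<Longrightarrow> substitute (twist g m) w = w"
proof (rule substitute_id)
  fix x assume "\<And>x. x \<in> set w \<Longrightarrow> fst x \<noteq> g" "x \<in> set w"
  then have "fst x \<noteq> g" by blast
  then show "twist g m x = [x]" by (cases x) auto
qed

lemma cyclic_length_syllable_word_twist_syllables:
  assumes "l \<noteq> []" "reduced_syllables (fst (hd l)) l"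
  shows "cyclic_length (substitute (twist g m) (syllable_word g l))
    = length (syllable_word g (twist_syllables m (fst (hd l)) l))"
proof (rule cyclic_length_eq)
  show "syllable_word g (twist_syllables m (fst (hd l)) l) \<sim> substitute (twist g m) (syllable_word g l)"
    by (rule conjugate_sym[OF twist_syllable_word[OF assms(1)]])
  have "twist_syllables m (fst (hd l)) l \<noteq> []"
    "fst (hd (twist_syllables m (fst (hd l)) l)) = fst (hd l)"
    using assms(1) by (cases l; auto)+
  then show "cyclically_reduced (syllable_word g (twist_syllables m (fst (hd l)) l))"
    using reduced_syllables_twist_syllables[OF assms(2)]
      by (simp add: cyclically_reduced_syllable_word)
qed

text \<open>
  Only the term \<open>repeats g\<close> depends on the generator; the term with the sign of the twist is
  common to both generators. This is what makes the length convex also where a path changes the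
  generator.
\<close>

lemma cyclic_length_twist:
  assumes "cyclically_reduced w" "s \<in> {1, -1}"
  shows "2 * int (cyclic_length (substitute (twist g s) w))
    = 2 * int (length w) + 2 * repeats g w + s * balance w"
proof (cases "\<exists>x \<in> set w. fst x = g")
  case False
  then have "substitute (twist g s) w = w" by (intro twist_no_letter) auto
  moreover have only: "fst x = other g" if "x \<in> set (w @ take 1 w)" for x
  proof -
    have "x \<in> set w" using that set_take_subset[of 1 w] by auto
    then show ?thesis using False neq_iff_other by blast
  qed
  have "repeats g w = 0" "balance w = 0"
    unfolding repeats_def balance_def cyclic_sum_def
      by (rule path_sum_zero, simp only: only if_True other_simps if_False simp_thms)+
  ultimately show ?thesis using assms by (simp add: cyclic_length_cyclically_reduced)
next
  case True
  then obtain i l where l: "rotate i w = syllable_word g l" "l \<noteq> []"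
    "reduced_syllables (fst (hd l)) l"
    using assms rotate_eq_syllable_word by metis
  have take1: "take 1 (syllable_word g l) = [(g, fst (hd l))]" using l(2) by (cases l) auto
  have "cyclic_length (substitute (twist g s) w)
    = cyclic_length (substitute (twist g s) (syllable_word g l))"
    unfolding l(1)[symmetric]
      by (intro cyclic_length_conj substitute_conjugate conjugate_sym[OF conjugate_rotate]) auto
  also have "\<dots> = length (syllable_word g (twist_syllables s (fst (hd l)) l))"
    using l by (simp add: cyclic_length_syllable_word_twist_syllables)
  finally have "2 * int (cyclic_length (substitute (twist g s) w))
    = 2 * int (length (syllable_word g l)) + 2 * repeats g (syllable_word g l)
      + s * balance (syllable_word g l)"
    using length_syllable_word_twist_syllables[OF l(3) assms(2), of g] take1
      by (simp only: repeats_def balance_def cyclic_sum_def)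
  moreover have "length (syllable_word g l) = length w"
    "repeats g (syllable_word g l) = repeats g w" "balance (syllable_word g l) = balance w"
    unfolding l(1)[symmetric] by (simp_all add: repeats_def balance_def cyclic_sum_rotate)
  ultimately show ?thesis by simp
qed

section \<open>Flat paths\<close>

lemma cyclically_reduced_conj_rotate:
  assumes "cyclically_reduced v" "cyclically_reduced w" "v \<sim> w"
  obtains i where "v = rotate i w"
  using cyclically_reduced_conjugate[OF assms(2,3) cyclically_reduced_reduced[OF assms(1)]]
    cyclically_reduced_conjugate[OF assms(1) conjugate_sym[OF assms(3)] cyclically_reduced_reduced[OF assms(2)]] that
  by auto

lemma repeats_conj: "cyclically_reduced v \<Longrightarrow> cyclically_reduced w \<Longrightarrow> v \<sim> w \<Longrightarrow> repeats g v = repeats g w"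
  by (erule (2) cyclically_reduced_conj_rotate) (simp add: repeats_def cyclic_sum_rotate)

text \<open>
  If some gap \<open>k\<close> is shifted at all, it is shifted by \<open>m\<close> or \<open>-m\<close>, and one of the two words
  contains a gap of at least half that size.
\<close>

lemma twist_syllables_power:
  "twist_syllables m e l = l
    \<or> \<bar>m\<bar> \<le> int (length (syllable_word g l)) + int (length (syllable_word g (twist_syllables m e l)))"
proof (induction l)
  case (Cons t l)
  obtain d k where t: "t = (d, k)" by (cases t)
  show ?case using Cons by (auto simp: t gap_shift_def)
qed simp

lemma twist_power:
  assumes "cyclically_reduced w"
  shows "substitute (twist g m) w
    \<sim> w \<or> \<bar>m\<bar> \<le> int (length w) + int (cyclic_length (substitute (twist g m) w))"
proof (cases "\<exists>x \<in> set w. fst x = g")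
  case False
  then have "substitute (twist g m) w = w" by (intro twist_no_letter) auto
  then show ?thesis by simp
next
  case True
  then obtain i l where l: "rotate i w = syllable_word g l" "l \<noteq> []"
    "reduced_syllables (fst (hd l)) l"
    using assms rotate_eq_syllable_word by metis
  have c: "substitute (twist g m) w \<sim> substitute (twist g m) (syllable_word g l)"
    unfolding l(1)[symmetric]
      by (intro substitute_conjugate conjugate_sym[OF conjugate_rotate]) auto
  have len: "length w = length (syllable_word g l)" by (simp flip: l(1))
  consider "twist_syllables m (fst (hd l)) l = l"
    | "\<bar>m\<bar>
      \<le> int (length (syllable_word g l))
        + int (length (syllable_word g (twist_syllables m (fst (hd l)) l)))"
    using twist_syllables_power by blast
  then show ?thesis
  proof cases
    case 1
    then have "substitute (twist g m) w \<sim> syllable_word g l"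
      using twist_syllable_word[OF l(2), of g m] c conjugate_trans by fastforce
    moreover have "syllable_word g l \<sim> w" unfolding l(1)[symmetric] by (rule conjugate_rotate)
    ultimately show ?thesis by (blast intro: conjugate_trans)
  next
    case 2
    then show ?thesis
      using cyclic_length_conj[OF c] cyclic_length_syllable_word_twist_syllables[OF l(2,3), of g m] len by simp
  qed
qed

lemma no_repeats_gap_nonzero:
  assumes "reduced_syllables e l"
    "path_sum (\<lambda>x y. if fst x = g \<and> fst y = g then 1 else 0) (syllable_word g l @ [(g, e)]) = 0"
    "(d, k) \<in> set l"
  shows "k \<noteq> 0"
  using assms
proof (induction l)
  case (Cons t l)
  obtain d' k' where t: "t = (d', k')" by (cases t)
  obtain r where r: "syllable_word g l @ [(g, e)] = (g, next_sign e l) # r"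
    using closed_syllable_word_Cons by blast
  have "path_sum (\<lambda>x y. if fst x = g \<and> fst y = g then 1 else 0) ((g, next_sign e l) # r) \<ge> 0"
    by (rule path_sum_nonneg) simp
  then show ?case using Cons by (auto simp: t r path_sum_gen_power split: if_splits)
qed simp

lemma no_other_repeats_gap_le_1:
  assumes "path_sum (\<lambda>x y. if fst x = other g \<and> fst y = other g then 1 else 0)
    (syllable_word g l @ [(g, e)]) = 0"
    "(d, k) \<in> set l"
  shows "\<bar>k\<bar> \<le> 1"
  using assms
proof (induction l)
  case (Cons t l)
  obtain d' k' where t: "t = (d', k')" by (cases t)
  obtain r where r: "syllable_word g l @ [(g, e)] = (g, next_sign e l) # r"
    using closed_syllable_word_Cons by blast
  have "path_sum (\<lambda>x y. if fst x = other g \<and> fst y = other g then 1 else 0) ((g, next_sign e l) # r) \<ge> 0"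
    by (rule path_sum_nonneg) simp
  then show ?case using Cons by (auto simp: t r path_sum_gen_power split: if_splits)
qed simp

lemma twist_syllables_alternating:
  assumes "\<And>d k. (d, k) \<in> set l \<Longrightarrow> \<bar>k\<bar> = 1" "\<And>d k. (d, k) \<in> set (twist_syllables s e l) \<Longrightarrow> k \<noteq> 0"
    "s \<in> {1, -1}"
  shows "length (syllable_word g l) \<le> length (syllable_word g (twist_syllables s e l)) \<and>
    (length (syllable_word g l)
      = length (syllable_word g (twist_syllables s e l)) \<longrightarrow> twist_syllables s e l = l)"
  using assms(1,2)
proof (induction l)
  case (Cons t l)
  obtain d k where t: "t = (d, k)" by (cases t)
  have k: "\<bar>k\<bar> = 1" "k + s * gap_shift d (next_sign e l) \<noteq> 0"
    using Cons.prems(1)[of d k] Cons.prems(2)[of d "k + s * gap_shift d (next_sign e l)"]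
      by (simp_all add: t)
  have IH: "length (syllable_word g l) \<le> length (syllable_word g (twist_syllables s e l))"
    "length (syllable_word g l)
      = length (syllable_word g (twist_syllables s e l)) \<longrightarrow> twist_syllables s e l = l"
    using Cons.IH Cons.prems by (auto simp: t)
  have "s * gap_shift d (next_sign e l) \<in> {-1, 0, 1}" using assms(3) by (auto simp: gap_shift_def)
  then show ?case using IH k by (auto simp: t abs_if split: if_splits)
qed simp

text \<open>
  All gaps have size one, because neither generator is repeated. A shifted gap cannot become
  empty, since the twisted word does not repeat \<open>g\<close>; so it would have size two. As the length is
  unchanged, no gap is shifted.
\<close>

lemma twist_alternating:
  assumes "cyclically_reduced w" "repeats g w = 0" "repeats (other g) w = 0" "s \<in> {1, -1}"
    "cyclic_length (substitute (twist g s) w) = length w" "cyclically_reduced v"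
      "v \<sim> substitute (twist g s) w" "repeats g v = 0"
  shows "substitute (twist g s) w \<sim> w"
proof (cases "\<exists>x \<in> set w. fst x = g")
  case False
  then have "substitute (twist g s) w = w" by (intro twist_no_letter) auto
  then show ?thesis by simp
next
  case True
  then obtain i l where l: "rotate i w = syllable_word g l" "l \<noteq> []"
    "reduced_syllables (fst (hd l)) l"
    using assms rotate_eq_syllable_word by metis
  define e where "e = fst (hd l)"
  have twist_syllables_ne: "twist_syllables s e l \<noteq> []"
    and hd_twist_syllables: "fst (hd (twist_syllables s e l)) = e"
    using l(2) by (cases l; auto simp: e_def)+
  have c: "substitute (twist g s) w \<sim> substitute (twist g s) (syllable_word g l)"
    unfolding l(1)[symmetric]
      by (intro substitute_conjugate conjugate_sym[OF conjugate_rotate]) auto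
  have c': "substitute (twist g s) w \<sim> syllable_word g (twist_syllables s e l)"
    using conjugate_trans[OF c twist_syllable_word[OF l(2), of g s]] by (simp add: e_def)
  have cyc: "cyclically_reduced (syllable_word g (twist_syllables s e l))"
    using reduced_syllables_twist_syllables[OF l(3), of s]
      by (simp add: cyclically_reduced_syllable_word twist_syllables_ne hd_twist_syllables e_def[symmetric])
  have take1: "take 1 (syllable_word g l') = [(g, fst (hd l'))]" if "l' \<noteq> []" for l'
    using that by (cases l') auto
  have nn0: "repeats g (syllable_word g l) = 0" "repeats (other g) (syllable_word g l) = 0"
    "repeats g (syllable_word g (twist_syllables s e l)) = 0"
    using assms(2,3) repeats_conj[OF assms(6) cyc conjugate_trans[OF assms(7) c'], of g] assms(8)
    unfolding l(1)[symmetric] by (simp_all add: repeats_def cyclic_sum_rotate)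
  have "k \<noteq> 0" "\<bar>k\<bar> \<le> 1" if "(d, k) \<in> set l" for d k
    using no_repeats_gap_nonzero[OF l(3) nn0(1)[unfolded repeats_def cyclic_sum_def take1[OF l(2)]] that]
      no_other_repeats_gap_le_1[OF nn0(2)[unfolded repeats_def cyclic_sum_def take1[OF l(2)]] that]
        by simp_all
  then have 1: "\<bar>k\<bar> = 1" if "(d, k) \<in> set l" for d k
    using that by fastforce
  have 2: "k \<noteq> 0" if "(d, k) \<in> set (twist_syllables s e l)" for d k
    using no_repeats_gap_nonzero[OF reduced_syllables_twist_syllables[OF l(3), of s, folded e_def]
        nn0(3)[unfolded repeats_def cyclic_sum_def take1[OF twist_syllables_ne] hd_twist_syllables] that] .
  have "length (syllable_word g l) = length (syllable_word g (twist_syllables s e l))"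
    using assms(5) cyclic_length_conj[OF c'] cyclic_length_cyclically_reduced[OF cyc]
      by (simp flip: l(1))
  then have "twist_syllables s e l = l"
    using twist_syllables_alternating[OF 1 2 assms(4), where g = g] by simp
  then have "substitute (twist g s) w \<sim> rotate i w" using c' l(1) by simp
  then show ?thesis using conjugate_rotate by (rule conjugate_trans)
qed

text \<open>
  The first generator of the list is the first twist that is applied.
\<close>

fun positive_path :: "gen2 list \<Rightarrow> gen2 letter list \<Rightarrow> gen2 letter list" where
  "positive_path [] w = w"
| "positive_path (g # gs) w = positive_path gs (substitute (twist g 1) w)"

lemma positive_path_conj: "u \<sim> v \<Longrightarrow> positive_path gs u \<sim> positive_path gs v"
  by (induction gs arbitrary: u v) (auto intro: substitute_conjugate)

lemma twist_inverse: "substitute (twist g (-1)) (substitute (twist g 1) w) \<simeq> w"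
  "substitute (twist g 1) (substitute (twist g (-1)) w) \<simeq> w"
  using twist_twist[of g "-1" 1 w] twist_twist[of g 1 "-1" w] by simp_all

text \<open>
  At the middle word, the previous word is reached by \<open>twist g (-1)\<close> and the next one by \<open>twist h
  1\<close>; in the sum of the two changes of length the balance drops out.
\<close>

lemma convexity:
  assumes "cyclically_reduced v" "v \<sim> substitute (twist g 1) w"
  shows "int (cyclic_length (substitute (twist h 1) (substitute (twist g 1) w))) + int (cyclic_length w)
    = 2 * int (cyclic_length (substitute (twist g 1) w)) + repeats g v + repeats h v"
proof -
  have "substitute (twist g (-1)) v \<sim> substitute (twist g (-1)) (substitute (twist g 1) w)"
    "substitute (twist h 1) v \<sim> substitute (twist h 1) (substitute (twist g 1) w)"
    using assms by (auto intro: substitute_conjugate)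
  then have "cyclic_length (substitute (twist g (-1)) v) = cyclic_length w"
    "cyclic_length (substitute (twist h 1) v)
      = cyclic_length (substitute (twist h 1) (substitute (twist g 1) w))"
    using twist_inverse(1)[of g w] by (metis cyclic_length_conj conjugate_free_eq_trans(1))+
  moreover have "cyclic_length (substitute (twist g 1) w) = length v"
    using assms by (rule cyclic_length_eq)
  ultimately show ?thesis
    using cyclic_length_twist[OF assms(1), of "-1" g] cyclic_length_twist[OF assms(1), of 1 h]
      by simp
qed

lemma climb:
  "cyclic_length w < cyclic_length (substitute (twist g 1) w) \<Longrightarrow>
    cyclic_length w < cyclic_length (positive_path gs (substitute (twist g 1) w))"
proof (induction gs arbitrary: w g)
  case (Cons h gs)
  obtain v where v: "cyclically_reduced v" "v \<sim> substitute (twist g 1) w"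
    using cyclic_reduction_exists by blast
  have "cyclic_length (substitute (twist g 1) w) < cyclic_length (substitute (twist h 1) (substitute (twist g 1) w))"
    using convexity[OF v, of h] Cons.prems repeats_nonneg[of g v] repeats_nonneg[of h v] by simp
  from Cons.IH[OF this] Cons.prems show ?case by simp
qed simp

text \<open>
  Minimality along positive paths, the form in which the analysis of paths uses it.
\<close>

definition never_shorter :: "nat \<Rightarrow> gen2 letter list \<Rightarrow> bool" where
  "never_shorter n w \<longleftrightarrow> (\<forall>gs. n \<le> cyclic_length (positive_path gs w))"

lemma never_shorter_twist: "never_shorter n w \<Longrightarrow> never_shorter n (substitute (twist g 1) w)"
  unfolding never_shorter_def by (metis positive_path.simps(2))

lemma never_shorter_conj: "never_shorter n w \<Longrightarrow> v \<sim> w \<Longrightarrow> never_shorter n v"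
  unfolding never_shorter_def by (metis positive_path_conj cyclic_length_conj)

lemma flat_step:
  assumes "never_shorter n w" "cyclic_length w = n" "cyclic_length (positive_path (g # gs) w) = n"
  shows "cyclic_length (substitute (twist g 1) w) = n"
proof (rule ccontr)
  assume "cyclic_length (substitute (twist g 1) w) \<noteq> n"
  moreover have "n \<le> cyclic_length (substitute (twist g 1) w)"
    using assms(1) unfolding never_shorter_def by (metis positive_path.simps)
  ultimately have "cyclic_length w < cyclic_length (substitute (twist g 1) w)"
    using assms(2) by simp
  from climb[OF this, of gs] assms(2,3) show False by simp
qed

lemma flat_middle:
  assumes "cyclic_length w = n" "cyclic_length (substitute (twist g 1) w) = n"
    "cyclic_length (substitute (twist h 1) (substitute (twist g 1) w)) = n"
    "cyclically_reduced v" "v \<sim> substitute (twist g 1) w"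
  shows "repeats g v = 0" "repeats h v = 0"
  using convexity[OF assms(4,5), of h] repeats_nonneg[of g v] repeats_nonneg[of h v] assms(1-3)
    by simp_all

text \<open>
  By convexity at the word after the first twist, that word repeats no letter of the twisted
  generator; by \<open>twist_alternating\<close> the first twist fixes the cyclic word. Induction removes all
  twists but the last, for which no next word is at hand.
\<close>

lemma flat_alternating:
  assumes "cyclically_reduced v" "v \<sim> w" "repeats GenA v = 0" "repeats GenB v = 0"
    "never_shorter n w" "cyclic_length w = n"
    "cyclic_length (positive_path gs w) = n" "gs \<noteq> []"
  shows "positive_path gs w \<sim> substitute (twist (last gs) 1) w"
  using assms(7,8)
proof (induction gs)
  case (Cons g gs)
  show ?case
  proof (cases gs)
    case (Cons h hs)
    let ?w' = "substitute (twist g 1) w"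
    have 1: "cyclic_length ?w' = n" using flat_step[OF assms(5,6) Cons.prems(1)] .
    have 2: "cyclic_length (substitute (twist h 1) ?w') = n"
      using flat_step[OF never_shorter_twist[OF assms(5)] 1, of h hs] Cons.prems(1) Cons by simp
    obtain u where u: "cyclically_reduced u" "u \<sim> ?w'" using cyclic_reduction_exists by blast
    have nn0: "repeats g v = 0" "repeats (other g) v = 0" using assms(3,4) by (cases g; simp)+
    have vw: "substitute (twist g 1) v \<sim> ?w'"
      by (rule substitute_conjugate[OF equivariant_twist assms(2)])
    have "cyclic_length (substitute (twist g 1) v) = length v"
      using 1 assms(6) cyclic_length_conj[OF vw] cyclic_length_eq[OF assms(1,2)] by simp
    then have "substitute (twist g 1) v \<sim> v"
      using twist_alternating[OF assms(1) nn0 _ _ u(1) conjugate_trans[OF u(2) conjugate_sym[OF vw]]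
          flat_middle(1)[OF assms(6) 1 2 u]] by simp
    then have c: "?w' \<sim> w" using vw assms(2) by (blast intro: conjugate_trans conjugate_sym)
    have "positive_path (g # gs) w \<sim> positive_path gs w"
      using positive_path_conj[OF c, of gs] by simp
    moreover have "positive_path gs w \<sim> substitute (twist (last gs) 1) w"
      using Cons.IH Cons.prems(1) cyclic_length_conj[OF \<open>positive_path (g # gs) w \<sim> positive_path gs w\<close>] Cons by simp
    ultimately show ?thesis using Cons by (auto intro: conjugate_trans)
  qed simp
qed simp

text \<open>
  As long as the path keeps the generator \<open>g\<close>, it stays among the powers of one twist. When it
  changes the generator, neither generator is repeated at that word, and \<open>flat_alternating\<close>
  applies.
\<close>

lemma flat_after_power:
  assumes "never_shorter n w" "m \<ge> 0" "cyclic_length (substitute (twist g m) w) = n"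
    "never_shorter n (substitute (twist g m) w)"
    "cyclic_length (positive_path (g # gs) (substitute (twist g m) w)) = n"
  shows "\<exists>k \<ge> 0. cyclic_length (substitute (twist g k) w) = n \<and>
    (positive_path (g # gs) (substitute (twist g m) w) \<sim> substitute (twist g k) w \<or>
     (\<exists>h. positive_path (g # gs) (substitute (twist g m) w)
       \<sim> substitute (twist h 1) (substitute (twist g k) w)))"
  using assms(2-)
proof (induction gs arbitrary: m)
  case Nil
  have c: "substitute (twist g 1) (substitute (twist g m) w) \<sim> substitute (twist g (m + 1)) w"
    using twist_twist[of g 1 m w] by (simp add: free_eq_imp_conj add.commute)
  then show ?case using Nil cyclic_length_conj[OF c] by (intro exI[of _ "m + 1"]) auto
next
  case (Cons h gs)
  let ?w = "substitute (twist g m) w"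
  have c: "substitute (twist g 1) ?w \<sim> substitute (twist g (m + 1)) w"
    using twist_twist[of g 1 m w] by (simp add: free_eq_imp_conj add.commute)
  have 1: "cyclic_length (substitute (twist g 1) ?w) = n" using flat_step[OF Cons.prems(3,2,4)] .
  have never_shorter: "never_shorter n (substitute (twist g 1) ?w)"
    using never_shorter_twist Cons.prems(3) by blast
  have p: "positive_path (g # h # gs) ?w \<sim> positive_path (h # gs) (substitute (twist g (m + 1)) w)"
    using positive_path_conj[OF c, of "h # gs"] by simp
  show ?case
  proof (cases "h = g")
    case True
    have "never_shorter n (substitute (twist g (m + 1)) w)"
      using never_shorter_conj[OF never_shorter conjugate_sym[OF c]] .
    moreover have "cyclic_length (positive_path (g # gs) (substitute (twist g (m + 1)) w)) = n"
      using cyclic_length_conj[OF p] Cons.prems(4) True by simp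
    ultimately obtain k where k: "k \<ge> 0" "cyclic_length (substitute (twist g k) w) = n"
      "positive_path (g # gs) (substitute (twist g (m + 1)) w) \<sim> substitute (twist g k) w \<or>
       (\<exists>h. positive_path (g # gs) (substitute (twist g (m + 1)) w)
         \<sim> substitute (twist h 1) (substitute (twist g k) w))"
      using Cons.IH[of "m + 1"] Cons.prems(1) cyclic_length_conj[OF c] 1 by auto
    with p True show ?thesis by (blast intro: conjugate_trans)
  next
    case False
    \<comment> \<open>The path changes its generator at \<open>v\<close>.\<close>
    obtain v where v: "cyclically_reduced v" "v \<sim> substitute (twist g 1) ?w"
      using cyclic_reduction_exists by blast
    have 2: "cyclic_length (substitute (twist h 1) (substitute (twist g 1) ?w)) = n"
      using flat_step[OF never_shorter 1, of h gs] Cons.prems(4) by simp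
    have "repeats GenA v = 0" "repeats GenB v = 0"
      using flat_middle[OF Cons.prems(2) 1 2 v] False by (cases g; cases h; simp)+
    then have "positive_path (h # gs) (substitute (twist g 1) ?w)
      \<sim> substitute (twist (last (h # gs)) 1) (substitute (twist g 1) ?w)"
      using flat_alternating[OF v _ _ never_shorter 1, of "h # gs"] Cons.prems(4) by simp
    also have "\<dots> \<sim> substitute (twist (last (h # gs)) 1) (substitute (twist g (m + 1)) w)"
      by (rule substitute_conjugate[OF equivariant_twist c])
    finally have "positive_path (g # h # gs) ?w
      \<sim> substitute (twist (last (h # gs)) 1) (substitute (twist g (m + 1)) w)" by simp
    then show ?thesis
      using Cons.prems(1) 1 cyclic_length_conj[OF c] by (intro exI[of _ "m + 1"]) auto
  qed
qed

lemma flat_paths: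
  assumes "never_shorter n w" "cyclic_length w = n" "cyclic_length (positive_path gs w) = n"
  obtains g h k where "0 \<le> k" "k \<le> 2 * int n"
    "positive_path gs w \<sim> substitute (twist g k) w \<or> positive_path gs w
      \<sim> substitute (twist h 1) (substitute (twist g k) w)"
proof (cases gs)
  case Nil
  then show thesis using that[of 0] by simp
next
  case (Cons g gs')
  obtain k h where k: "k \<ge> 0" "cyclic_length (substitute (twist g k) w) = n"
    "positive_path gs w \<sim> substitute (twist g k) w \<or> positive_path gs w
      \<sim> substitute (twist h 1) (substitute (twist g k) w)"
    using flat_after_power[of n w 0 g gs'] assms Cons by auto
  obtain v where v: "cyclically_reduced v" "v \<sim> w" using cyclic_reduction_exists by blast
  have len: "length v = n" using cyclic_length_eq[OF v] assms(2) by simp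
  have vw: "substitute (twist g k) v \<sim> substitute (twist g k) w"
    by (rule substitute_conjugate[OF equivariant_twist v(2)])
  show thesis
  proof (cases "substitute (twist g k) v \<sim> v")
    case True
    then have c: "substitute (twist g k) w \<sim> substitute (twist g 0) w"
      using vw v(2) by (auto intro: conjugate_trans conjugate_sym)
    have "positive_path gs w \<sim> substitute (twist g 0) w \<or> positive_path gs w
      \<sim> substitute (twist h 1) (substitute (twist g 0) w)"
      using k(3) c substitute_conjugate[OF equivariant_twist c, of h 1]
        by (blast intro: conjugate_trans)
    then show thesis using that[of 0 g h] by simp
  next
    case False
    then have "k \<le> 2 * int n"
      using twist_power[OF v(1), of g k] len cyclic_length_conj[OF vw] k(1,2) by simp
    then show thesis using that[of k g h] k by blast
  qed
qed

section \<open>Normal forms of automorphisms\<close>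

text \<open>
  The permutations of the letters induced by permuting and inverting the basis elements.
\<close>

definition signed :: "(gen2 letter \<Rightarrow> gen2 letter) \<Rightarrow> bool" where
  "signed m \<longleftrightarrow> bij m \<and> (\<forall>x. m (inv_letter x) = inv_letter (m x))"

definition normal_form :: "(gen2 letter list \<Rightarrow> gen2 letter list) \<Rightarrow> bool" where
  "normal_form \<phi> \<longleftrightarrow> (\<exists>\<sigma> \<tau> gs. signed \<sigma> \<and> signed \<tau> \<and> (\<forall>w. \<phi> w \<sim> map \<sigma> (positive_path gs (map \<tau> w))))"

lemma signed_id: "signed id"
  by (simp add: signed_def)

lemma signed_comp: "signed m \<Longrightarrow> signed n \<Longrightarrow> signed (m \<circ> n)"
  by (simp add: signed_def bij_comp del: inv_letter.simps split_paired_All)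

lemma map_signed_conj: "signed m \<Longrightarrow> u \<sim> v \<Longrightarrow> map m u \<sim> map m v"
  using substitute_conjugate[of "\<lambda>x. [m x]" u v]
    by (simp add: equivariant_def signed_def del: inv_letter.simps)

lemma normal_form_conj: "normal_form \<psi> \<Longrightarrow> (\<And>w. \<phi> w \<sim> \<psi> w) \<Longrightarrow> normal_form \<phi>"
  unfolding normal_form_def by (meson conjugate_trans)

lemma normal_form_signed: "signed m \<Longrightarrow> normal_form (map m)"
  unfolding normal_form_def
    by (rule exI[of _ m], rule exI[of _ id], rule exI[of _ "[]"]) (simp add: signed_id)

lemma substitute_map: "substitute F (map m w) = substitute (\<lambda>x. F (m x)) w"
  by (induction w) auto

lemma map_substitute: "map m (substitute F w) = substitute (\<lambda>x. map m (F x)) w"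
  by (induction w) auto

lemma map_gen_power:
  "(\<And>b. m (h, b) = (k, b = f)) \<Longrightarrow> map m (gen_power h t) = gen_power k (if f then t else - t)"
  by (cases "t = 0") (auto simp: gen_power_def)

lemma gen_power_commute_letter: "gen_power h t @ [(h, b)] @ gen_power h (- t) \<simeq> [(h, b)]"
proof -
  obtain j where "[(h, b)] = gen_power h j" by (metis gen_power_1 gen_power_m1)
  moreover have "gen_power h t @ gen_power h j @ gen_power h (- t) \<simeq> gen_power h (t + (j + - t))"
    by (rule free_eq_trans[OF free_eq_append[OF free_eq_refl gen_power_add] gen_power_add])
  ultimately show ?thesis by simp
qed

text \<open>
  A signed permutation maps the generators of a twist to the generators of another one. If it
  sends \<open>g\<close> to an inverse letter, the exponent ends up on the other side, which conjugation by a
  power of the fixed generator repairs.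
\<close>

lemma signed_twist:
  assumes "signed m" "s \<in> {1, -1}"
  shows "\<exists>g' s'. s' \<in> {1, -1} \<and> (\<forall>w. map m (substitute (twist g s) w) \<sim> substitute (twist g' s') (map m w))"
proof -
  obtain g' e where g: "m (g, True) = (g', e)" by (cases "m (g, True)")
  obtain k f where k: "m (other g, True) = (k, f)" by (cases "m (other g, True)")
  have inv: "m (x, False) = inv_letter (m (x, True))" for x
    using assms(1) unfolding signed_def by (metis inv_letter.simps)
  have inj: "inj m" using assms(1) by (simp add: signed_def bij_def)
  have "k \<noteq> g'"
  proof
    assume "k = g'"
    then have "m (other g, True) = m (g, e = f)" using g k inv[of g] by (cases "e = f") auto
    then show False using injD[OF inj, of "(other g, True)" "(g, e = f)"] by simp
  qed
  then have k': "k = other g'" by (simp add: neq_iff_other)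
  have mg: "m (g, b) = (g', b = e)" for b
    using inv[of g] by (cases b) (simp_all add: g)
  have mo: "m (other g, b) = (other g', b = f)" for b
    using inv[of "other g"] by (cases b) (simp_all add: k k')
  define s' where "s' = (if e = f then s else - s)"
  \<comment> \<open>The conjugator moves the power of the fixed generator behind the inverted image of
     \<open>g\<close>.\<close>
  define c where "c = (if e then [] else gen_power (other g') s')"
  have "map m (twist g s x) \<simeq> c @ twist g' s' (m x) @ inverse_word c" for x
  proof (cases "fst x = g")
    case False
    then obtain b where x: "x = (other g, b)" by (cases x) (auto simp: neq_iff_other)
    show ?thesis using free_eq_sym[OF gen_power_commute_letter[of "other g'" s' "b = f"]]
      by (simp add: x mo c_def)
  next
    case True
    then obtain b where x: "x = (g, b)" by (cases x) auto
    note gp = map_gen_power[of m "other g" "other g'" f, OF mo]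
    show ?thesis
    proof (cases e)
      case True
      then show ?thesis by (cases b) (auto simp: x mg gp c_def s'_def)
    next
      case False
      show ?thesis
      proof (cases b)
        case True
        have "map m (twist g s x) = (g', False) # gen_power (other g') (- s')"
          using False True by (simp add: x mg gp s'_def)
        moreover have "c @ twist g' s' (m x) @ inverse_word c \<simeq> (g', False) # gen_power (other g') (- s')"
          using free_eq_cancel(1)[of "[]" "gen_power (other g') s'"
            "(g', False) # gen_power (other g') (- s')"] False True
          by (simp add: x mg c_def)
        ultimately show ?thesis by (simp add: free_eq_sym)
      next
        case b: False
        have "map m (twist g s x) = gen_power (other g') s' @ [(g', True)]"
          using False b by (simp add: x mg gp s'_def)
        moreover have "c @ twist g' s' (m x) @ inverse_word c \<simeq> gen_power (other g') s' @ [(g', True)]"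
          using free_eq_cancel(1)[of "gen_power (other g') s' @ [(g', True)]"
            "gen_power (other g') s'" "[]"] False b
          by (simp add: x mg c_def)
        ultimately show ?thesis by (simp add: free_eq_sym)
      qed
    qed
  qed
  then have "map m (substitute (twist g s) w) \<sim> substitute (twist g' s') (map m w)" for w
    unfolding map_substitute substitute_map by (rule substitute_conjugated_conjugate)
  moreover have "s' \<in> {1, -1}" using assms(2) by (auto simp: s'_def)
  ultimately show ?thesis by blast
qed

definition flip :: "gen2 \<Rightarrow> gen2 letter \<Rightarrow> gen2 letter" where
  "flip h x = (if fst x = h then inv_letter x else x)"

lemma signed_flip: "signed (flip h)"
  unfolding signed_def by (auto simp: flip_def intro!: involuntory_imp_bij)

lemma twist_flip:
  "substitute (twist g (-1)) w = map (flip (other g)) (substitute (twist g 1) (map (flip (other g)) w))"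
  unfolding substitute_map map_substitute
    by (rule arg_cong[where f = "\<lambda>F. substitute F w"]) (auto simp: flip_def fun_eq_iff)

text \<open>
  The automorphism \<open>g \<mapsto> o\<close>-inverse, \<open>o \<mapsto> g\<close>; in abelianised form, a rotation by a right angle.
\<close>

definition turn :: "gen2 \<Rightarrow> gen2 letter \<Rightarrow> gen2 letter" where
  "turn g x = (if fst x = g then (other g, \<not> snd x) else (g, snd x))"

lemma signed_turn: "signed (turn g)"
proof -
  have "turn (other g) (turn g x) = x" "turn g (turn (other g) x) = x" for x
    by (cases x; auto simp: turn_def neq_iff_other)+
  then have "bij (turn g)" by (intro o_bij[of "turn (other g)"]) auto
  then show ?thesis by (auto simp: signed_def turn_def)
qed

text \<open>
  In matrix terms this is the factorisation of an element of order six of \<open>SL\<^sub>2(\<int>)\<close>; it eliminates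
  a negative twist that meets a positive twist of the other generator.
\<close>

lemma opposite_twists_turn:
  "substitute (twist (other g) 1) (substitute (twist g (-1)) w) \<sim> substitute (twist g 1) (map (turn g) w)"
  unfolding substitute_map substitute_substitute
proof (rule substitute_conjugated_conjugate[of _ "[(other g, True)]"])
  fix x :: "gen2 letter"
  show "substitute (twist (other g) 1) (twist g (-1) x)
    \<simeq> [(other g, True)] @ twist g 1 (turn g x) @ inverse_word [(other g, True)]"
    by (cases x; cases "fst x"; cases "snd x"; cases g) (auto simp: free_eq_def reduce_def turn_def)
qed

text \<open>
  A twist is moved leftwards through \<open>\<tau>\<close>. If it becomes negative, it cancels with the first
  positive twist, or is absorbed by it at the cost of a signed permutation, or, if no positive
  twist is present, becomes positive by conjugation with the inversion of one generator.
\<close>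

lemma normal_form_twist:
  assumes "normal_form \<psi>" "s \<in> {1, -1}"
  shows "normal_form (\<lambda>w. \<psi> (substitute (twist g s) w))"
proof -
  obtain \<sigma> \<tau> gs where \<psi>: "signed \<sigma>" "signed \<tau>" "\<And>w. \<psi> w \<sim> map \<sigma> (positive_path gs (map \<tau> w))"
    using assms(1) unfolding normal_form_def by blast
  obtain t h where t: "t \<in> {1, -1}"
    "\<And>w. map \<tau> (substitute (twist g s) w) \<sim> substitute (twist h t) (map \<tau> w)"
    using signed_twist[OF \<psi>(2) assms(2), of g] by blast
  have *: "\<psi> (substitute (twist g s) w) \<sim> map \<sigma> (positive_path gs (substitute (twist h t) (map \<tau> w)))" for w
    by (rule conjugate_trans[OF \<psi>(3)]) (intro map_signed_conj positive_path_conj t(2) \<psi>(1))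
  show ?thesis
  proof (cases "t = 1")
    case True
    then show ?thesis using \<psi>(1,2) *
      unfolding normal_form_def by (intro exI[of _ \<sigma>] exI[of _ \<tau>] exI[of _ "h # gs"]) simp
  next
    case False
    then have t: "t = -1" using t(1) by simp
    show ?thesis
    proof (cases gs)
      case Nil
      let ?\<alpha> = "flip (other h)"
      have "\<psi> (substitute (twist g s) w) \<sim> map (\<sigma> \<circ> ?\<alpha>) (positive_path [h] (map (?\<alpha> \<circ> \<tau>) w))" for w
        using *[of w] by (simp add: t Nil twist_flip)
      then show ?thesis using \<psi>(1,2) signed_comp signed_flip unfolding normal_form_def by blast
    next
      case (Cons k ks)
      show ?thesis
      proof (cases "k = h")
        case True
        have "\<psi> (substitute (twist g s) w) \<sim> map \<sigma> (positive_path ks (map \<tau> w))" for w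
          using conjugate_trans[OF *[of w]]
            map_signed_conj[OF \<psi>(1) positive_path_conj[OF free_eq_imp_conj[OF twist_inverse(2)]], of ks h "map \<tau> w"]
          by (simp add: Cons t True)
        then show ?thesis using \<psi>(1,2) unfolding normal_form_def by blast
      next
        case False
        then have k: "k = other h" by (simp add: neq_iff_other)
        have "\<psi> (substitute (twist g s) w) \<sim> map \<sigma> (positive_path (h # ks) (map (turn h \<circ> \<tau>) w))" for w
          using conjugate_trans[OF *[of w]]
            map_signed_conj[OF \<psi>(1) positive_path_conj[OF opposite_twists_turn], of ks h "map \<tau> w"]
          by (simp add: Cons t k)
        then show ?thesis using \<psi>(1,2) signed_comp signed_turn unfolding normal_form_def by blast
      qed
    qed
  qed
qed

section \<open>Nielsen reduction\<close>

text \<open>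
  The substitutions that induce automorphisms.
\<close>

definition basis :: "(gen2 letter \<Rightarrow> gen2 letter list) \<Rightarrow> bool" where
  "basis V \<longleftrightarrow> equivariant V \<and> (\<forall>x. reduced (V x)) \<and>
     (\<forall>w. substitute V w \<simeq> [] \<longrightarrow> w \<simeq> []) \<and> (\<forall>x. \<exists>w. substitute V w \<simeq> [x])"

lemma basis_surj: "basis V \<Longrightarrow> \<exists>w. substitute V w \<simeq> u"
proof (induction u)
  case Nil
  show ?case by (rule exI[of _ "[]"]) simp
next
  case (Cons x u)
  then obtain w v where "substitute V w \<simeq> u" "substitute V v \<simeq> [x]" unfolding basis_def by blast
  from free_eq_append[OF this(2,1)] have "substitute V (v @ w) \<simeq> x # u" by simp
  then show ?case by blast
qed

lemma reduce_inverse_word: "reduce (inverse_word u) = inverse_word (reduce u)"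
  by (rule free_eq_reduced[OF free_eq_trans[OF free_eq_reduce(1) free_eq_inverse_word[OF free_eq_reduce(2)]]])
    (simp_all add: reduced_reduce)

text \<open>
  Precomposing with a twist and then conjugating is reversible, and costs only one twist in the
  normal form.
\<close>

lemma nielsen_twist:
  fixes g :: gen2 and s :: int and h :: "gen2 letter list"
  assumes V: "basis V"
  defines "V' \<equiv> (\<lambda>x. reduce (inverse_word h @ substitute V (twist g s x) @ h))"
  shows "substitute V' w \<simeq> inverse_word h @ substitute V (substitute (twist g s) w) @ h"
    and "basis V'"
    and "s \<in> {1, -1} \<Longrightarrow> normal_form (substitute V') \<Longrightarrow> normal_form (substitute V)"
proof -
  have eq: "equivariant V" using V by (simp add: basis_def)
  have V': "substitute V' w \<simeq> inverse_word h @ substitute V (substitute (twist g s) w) @ h" for w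
    using substitute_conjugated[of V' "inverse_word h" "\<lambda>x. substitute V (twist g s x)" w]
    by (simp add: V'_def substitute_substitute)
  then show "substitute V' w \<simeq> inverse_word h @ substitute V (substitute (twist g s) w) @ h" .
  have undo: "substitute V (substitute (twist g s) (substitute (twist g (- s)) w)) \<simeq> substitute V w" for w
    using substitute_free_eq[OF eq twist_twist[of g s "- s" w]] by simp
  have "equivariant V'"
    unfolding equivariant_def
  proof
    fix x
    have "twist g s (inv_letter x) = inverse_word (twist g s x)"
      using equivariant_twist[of g s] unfolding equivariant_def by blast
    then have "V' (inv_letter x) = reduce (inverse_word (inverse_word h @ substitute V (twist g s x) @ h))"
      using substitute_inverse_word[OF eq] by (simp add: V'_def)
    then show "V' (inv_letter x) = inverse_word (V' x)"
      unfolding reduce_inverse_word by (simp add: V'_def)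
  qed
  moreover have "w \<simeq> []" if "substitute V' w \<simeq> []" for w
  proof -
    have "inverse_word h @ substitute V (substitute (twist g s) w) @ h \<simeq> []"
      using free_eq_trans[OF free_eq_sym[OF V'] that] .
    then have "substitute V (substitute (twist g s) w) @ h \<simeq> h" by (simp add: free_eq_move_left)
    then have "substitute V (substitute (twist g s) w) \<simeq> h @ inverse_word h"
      by (simp add: free_eq_move_right)
    then have "substitute V (substitute (twist g s) w) \<simeq> []"
      using inverse_word_right by (rule free_eq_trans)
    then have "substitute (twist g s) w \<simeq> []" using V unfolding basis_def by blast
    then have "substitute (twist g (- s)) (substitute (twist g s) w) \<simeq> []"
      using substitute_free_eq[OF equivariant_twist] by fastforce
    then show ?thesis using free_eq_trans[OF free_eq_sym[OF twist_twist[of g "- s" s w]]] by simp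
  qed
  moreover have "\<exists>w. substitute V' w \<simeq> [x]" for x
  proof -
    obtain z where z: "substitute V z \<simeq> h @ [x] @ inverse_word h" using basis_surj[OF V] by blast
    have "substitute V' (substitute (twist g (- s)) z) \<simeq> inverse_word h @ substitute V z @ h"
      by (rule free_eq_trans[OF V']) (intro free_eq_append undo free_eq_refl)
    also have "\<dots> \<simeq> inverse_word h @ (h @ [x] @ inverse_word h) @ h"
      by (intro free_eq_append z free_eq_refl)
    also have "\<dots> \<simeq> [x]"
      using free_eq_trans[of "inverse_word h @ h @ [x] @ inverse_word h @ h"
        "[x] @ inverse_word h @ h" "[x]"]
        free_eq_cancel(2)[of "[]" h "[x] @ inverse_word h @ h"] free_eq_cancel(2)[of "[x]" h "[]"]
          by simp
    finally show ?thesis by blast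
  qed
  ultimately show "basis V'" unfolding basis_def by (simp add: V'_def reduced_reduce)
  assume "s \<in> {1, -1}" "normal_form (substitute V')"
  moreover from this have "- s \<in> {1, -1}" by auto
  ultimately have "normal_form (\<lambda>w. substitute V' (substitute (twist g (- s)) w))"
    by (intro normal_form_twist)
  moreover have "substitute V w \<sim> substitute V' (substitute (twist g (- s)) w)" for w
  proof -
    have "substitute V' (substitute (twist g (- s)) w)
      \<sim> substitute V (substitute (twist g s) (substitute (twist g (- s)) w))"
      using V' wconjI[of _ "inverse_word h"] by simp
    with undo show ?thesis by (meson conjugate_sym conjugate_free_eq_trans(1))
  qed
  ultimately show "normal_form (substitute V)" by (rule normal_form_conj)
qed

text \<open>
  The Nielsen move that replaces the image of \<open>y\<close> by the inverse image of \<open>x\<close> times the image of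
  \<open>y\<close>, followed by a conjugation. Up to conjugation it is a twist of the generator of \<open>y\<close>,
  whichever signs \<open>x\<close> and \<open>y\<close> have.
\<close>

lemma nielsen_step:
  assumes V: "basis V" and xy: "fst x \<noteq> fst y"
  obtains V' where "basis V'" "normal_form (substitute V') \<Longrightarrow> normal_form (substitute V)"
    "V' x = reduce (inverse_word h @ V x @ h)"
      "V' y = reduce (inverse_word h @ inverse_word (V x) @ V y @ h)"
proof -
  obtain g b where y: "y = (g, b)" by (cases y)
  obtain e where x: "x = (other g, e)" using xy y by (cases x) (auto simp: neq_iff_other)
  have eq: "V (inv_letter x) = inverse_word (V x)"
    using V unfolding basis_def equivariant_def by blast
  show thesis
  proof (cases b)
    case False
    define s :: int where "s = (if e then 1 else -1)"
    have s: "s \<in> {1, -1}" by (simp add: s_def)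
    have twist: "twist g s x = [x]" "twist g s y = [inv_letter x, y]"
      using False by (auto simp: s_def x y)
    show thesis
      by (rule that[OF nielsen_twist(2,3)[OF V, where s = s and g = g
        and h = h], OF s]) (simp_all add: twist eq del: twist.simps)
  next
    case True
    define s :: int where "s = (if e then -1 else 1)"
    have s: "s \<in> {1, -1}" by (simp add: s_def)
    have twist: "twist g s x = [x]" "twist g s y = [y, inv_letter x]"
      using True by (auto simp: s_def x y)
    let ?h = "V x @ h"
    show thesis
    proof (rule that[OF nielsen_twist(2,3)[OF V, where s = s and g = g and h = ?h], OF s])
      show "reduce (inverse_word ?h @ substitute V (twist g s x) @ ?h) = reduce (inverse_word h @ V x @ h)"
        using free_eq_cancel(2)[of "inverse_word h" "V x" "V x @ h"]
          by (simp add: twist free_eq_def del: twist.simps)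
      show "reduce (inverse_word ?h @ substitute V (twist g s y) @ ?h)
        = reduce (inverse_word h @ inverse_word (V x) @ V y @ h)"
        using free_eq_cancel(2)[of "inverse_word h @ inverse_word (V x) @ V y" "V x" h]
          by (simp add: twist eq free_eq_def del: twist.simps)
    qed
  qed
qed

fun lcp :: "'a list \<Rightarrow> 'a list \<Rightarrow> nat" where
  "lcp (x # u) (y # v) = (if x = y then Suc (lcp u v) else 0)"
| "lcp _ _ = 0"

lemma lcp_commute: "lcp u v = lcp v u"
  by (induction u v rule: lcp.induct) auto

lemma lcp_split:
  obtains c u' v' where "u = c @ u'" "v = c @ v'" "length c = lcp u v"
    "u' = [] \<or> v' = [] \<or> hd u' \<noteq> hd v'"
proof (induction u v arbitrary: thesis rule: lcp.induct)
  case (1 x u y v)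
  show ?case
  proof (cases "x = y")
    case True
    obtain c u' v' where "u = c @ u'" "v = c @ v'" "length c = lcp u v"
      "u' = [] \<or> v' = [] \<or> hd u' \<noteq> hd v'"
      using 1(1)[OF True] by blast
    with True show ?thesis using 1(2)[of "x # c"] by simp
  qed (use 1(2)[of "[]"] in simp)
next
  case ("2_1" v)
  show ?case by (rule "2_1"[of "[]" "[]" v]) auto
next
  case ("2_2" u)
  show ?case by (rule "2_2"[of "[]" u "[]"]) auto
qed

text \<open>
  Otherwise the word would be anti-symmetric about its middle, where a letter would be its own
  inverse or would cancel with its neighbour.
\<close>

lemma lcp_inverse_word:
  assumes "reduced u" "u \<noteq> []"
  shows "2 * lcp u (inverse_word u) < length u"
proof (rule ccontr)
  assume "\<not> ?thesis"
  then have ge: "length u \<le> 2 * lcp u (inverse_word u)" by simp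
  obtain c u' v' where c: "u = c @ u'" "inverse_word u = c @ v'" "length c = lcp u (inverse_word u)"
    by (rule lcp_split[of u "inverse_word u"])
  have nth: "u ! i = inv_letter (u ! (length u - Suc i))" if "i < length c" for i
  proof -
    have "i < length u" using that c(1) by simp
    have "u ! i = c ! i" using that c(1) by (simp add: nth_append)
    also have "\<dots> = inverse_word u ! i" using that c(2) by (simp add: nth_append)
    also have "inverse_word u ! i = inv_letter (u ! (length u - Suc i))"
      using \<open>i < length u\<close> by (simp add: inverse_word_def rev_nth)
    finally show ?thesis .
  qed
  show False
  proof (cases "even (length u)")
    case True
    then obtain n where n: "length u = 2 * n" by blast
    then obtain k where k: "n = Suc k" using assms(2) by (cases n) auto
    have "u ! k = inv_letter (u ! Suc k)" using nth[of k] ge c(3) n k by simp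
    moreover have "u ! Suc k \<noteq> inv_letter (u ! k)"
      using assms(1) n k unfolding reduced_def by (auto simp: successively_conv_nth)
    ultimately show False by simp
  next
    case False
    then obtain n where n: "length u = Suc (2 * n)" by (metis oddE Suc_eq_plus1)
    then show False using nth[of n] ge c(3) by simp
  qed
qed

text \<open>
  The number of letters of \<open>V x\<close> that cancel against the image of the next letter.
\<close>

definition overlap :: "('b letter \<Rightarrow> 'c letter list) \<Rightarrow> 'b letter \<Rightarrow> 'b letter list \<Rightarrow> nat" where
  "overlap V x w = (if w = [] then 0 else lcp (V (inv_letter x)) (V (hd w)))"

text \<open>
  The condition says that the cancellations at the two ends of an image never use it up. So at
  least one letter of each image survives, and once the common prefixes are removed, the letters
  at the cuts do not cancel.
\<close>

lemma nielsen_growth: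
  assumes eq: "equivariant V" and red: "\<And>x. reduced (V x)"
    and cond: "\<And>x y z. y \<noteq> x \<Longrightarrow> z \<noteq> inv_letter x \<Longrightarrow>
      lcp (V y) (V x) + lcp (V (inv_letter x)) (V z) < length (V x)"
  shows "reduced (x # w) \<Longrightarrow>
    \<exists>R. substitute V (x # w) \<simeq> take (length (V x) - overlap V x w) (V x) @ R \<and>
      reduced (take (length (V x) - overlap V x w) (V x) @ R) \<and> length w \<le> length R"
proof (induction w arbitrary: x)
  case Nil
  show ?case by (rule exI[of _ "[]"]) (simp add: red overlap_def)
next
  case (Cons y w)
  define c' where "c' = overlap V y w"
  have yw: "reduced (y # w)" and yx: "y \<noteq> inv_letter x" "w \<noteq> [] \<Longrightarrow> hd w \<noteq> inv_letter y"
    using Cons.prems by (auto simp: reduced_Cons)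
  obtain R where R: "substitute V (y # w) \<simeq> take (length (V y) - c') (V y) @ R"
    "reduced (take (length (V y) - c') (V y) @ R)" "length w \<le> length R"
    using Cons.IH[OF yw] unfolding c'_def by blast
  obtain C u v where C: "V (inv_letter x) = C @ u" "V y = C @ v"
    "length C = lcp (V (inv_letter x)) (V y)" "u = [] \<or> v = [] \<or> hd u \<noteq> hd v"
    by (rule lcp_split)
  have lt: "length C + c' < length (V y)"
  proof (cases "w = []")
    case True
    have "inv_letter x \<noteq> y" using yx(1) by auto
    then show ?thesis
      using cond[of "inv_letter x" y y] yx C(3) True by (simp add: c'_def overlap_def)
  next
    case False
    have "inv_letter x \<noteq> y" using yx(1) by auto
    then show ?thesis
      using cond[of "inv_letter x" y "hd w"] yx(2) C(3) False by (simp add: c'_def overlap_def)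
  qed
  define q where "q = take (length (V y) - c' - length C) v"
  have q: "take (length (V y) - c') (V y) = C @ q"
    using lt C(2) by (simp add: q_def)
  have "q \<noteq> []" "v \<noteq> []" "hd q = hd v"
    using lt C(2) by (auto simp: q_def hd_take)
  have Vx: "V x = inverse_word u @ inverse_word C"
  proof -
    have "V x = inverse_word (V (inv_letter x))"
      using eq unfolding equivariant_def by (metis inv_letter_invol)
    then show ?thesis by (simp add: C(1))
  qed
  have take: "take (length (V x) - lcp (V (inv_letter x)) (V y)) (V x) = inverse_word u"
    unfolding C(3)[symmetric] by (simp add: Vx)
  have "substitute V (x # y # w) \<simeq> V x @ (C @ q) @ R"
    using free_eq_append[OF free_eq_refl[of "V x"] R(1)] by (simp add: q)
  also have "\<dots> \<simeq> inverse_word u @ q @ R"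
    using free_eq_cancel(2)[of "inverse_word u" C "q @ R"] by (simp add: Vx)
  finally have 1: "substitute V (x # y # w) \<simeq> inverse_word u @ q @ R" .
  have "reduced (q @ R)" using R(2) by (simp add: q reduced_append)
  moreover have "reduced (inverse_word u)" using red[of x] by (simp only: Vx reduced_append)
  moreover have "hd (q @ R) \<noteq> inv_letter (last (inverse_word u))" if "inverse_word u \<noteq> []"
    using that C(4) \<open>q \<noteq> []\<close> \<open>v \<noteq> []\<close> \<open>hd q = hd v\<close> by (cases u) auto
  ultimately have 2: "reduced (inverse_word u @ q @ R)"
    unfolding reduced_append[of "inverse_word u"] by blast
  have 3: "length (y # w) \<le> length (q @ R)" using R(3) \<open>q \<noteq> []\<close> by (cases q) auto
  show ?case using 1 2 3 take by (intro exI[of _ "q @ R"]) (simp add: overlap_def)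
qed

lemma nielsen_length:
  assumes eq: "equivariant V" and red: "\<And>x. reduced (V x)"
    and cond: "\<And>x y z. y \<noteq> x \<Longrightarrow> z \<noteq> inv_letter x \<Longrightarrow>
      lcp (V y) (V x) + lcp (V (inv_letter x)) (V z) < length (V x)"
    and w: "reduced w"
  shows "length w \<le> length (reduce (substitute V w))"
proof (cases w)
  case (Cons x w')
  let ?c = "overlap V x w'"
  obtain R where R: "substitute V w \<simeq> take (length (V x) - ?c) (V x) @ R"
    "reduced (take (length (V x) - ?c) (V x) @ R)" "length w' \<le> length R"
    using nielsen_growth[of V x w'] assms Cons by auto
  have "?c < length (V x)"
    using cond[of "inv_letter x" x "hd w'"] cond[of "inv_letter x" x x] w Cons
    by (cases "w' = []") (auto simp: reduced_Cons overlap_def)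
  moreover have "reduce (substitute V w) = take (length (V x) - ?c) (V x) @ R"
    using R(1,2) by (metis free_eq_def reduce_reduced)
  ultimately show ?thesis using R(3) Cons by simp
qed simp

lemma finite_letters: "finite (UNIV :: gen2 letter set)"
proof -
  have "x \<in> {GenA, GenB} \<times> UNIV" for x :: "gen2 letter" by (cases x; cases "fst x") auto
  then have "UNIV \<subseteq> {GenA, GenB} \<times> (UNIV :: bool set)" by blast
  then show ?thesis by (rule finite_subset) simp
qed

text \<open>
  Nielsen reduction by induction on the total length of the images. If no Nielsen move followed by
  a conjugation shortens the images, then at most half of an image cancels on either side, and not
  exactly half on both sides; so substitution does not shorten reduced words (\<open>nielsen_length\<close>).
  Since every letter is in the image, every letter is the image of a letter.
\<close>

lemma normal_form_basis: "basis V \<Longrightarrow> normal_form (substitute V)"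
proof (induction "length (V (GenA, True)) + length (V (GenB, True))" arbitrary: V rule: less_induct)
  case less
  have eq: "equivariant V" and red: "reduced (V x)" for x
    using less.prems unfolding basis_def by blast+
  have len_inv: "equivariant W \<Longrightarrow> length (W (g, False)) = length (W (g, True))" for W g
    unfolding equivariant_def by (metis inv_letter.simps inverse_word_simps(5))
  have size: "length (W (GenA, True)) + length (W (GenB, True)) = length (W x) + length (W y)"
    if "equivariant W" "fst x \<noteq> fst y" for W x y
    using that(2) len_inv[OF that(1)]
    by (cases x; cases y; cases "fst x"; cases "fst y"; cases "snd x"; cases "snd y") auto
  have Vinv: "V (inv_letter x) = inverse_word (V x)" for x
    using eq unfolding equivariant_def by blast
  have ne: "V x \<noteq> []" for x
  proof
    assume "V x = []"
    then have "substitute V [x] \<simeq> []" by simp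
    then have "[x] \<simeq> []" using less.prems unfolding basis_def by blast
    then show False by (simp add: free_eq_def reduce_def)
  qed
  show ?case
  proof (cases "\<exists>x y h. fst x \<noteq> fst y \<and>
      length (reduce (inverse_word h @ V x @ h)) + length (reduce (inverse_word h
        @ inverse_word (V x) @ V y @ h)) < length (V x) + length (V y)")
    case True
    then obtain x y h where xy: "fst x \<noteq> fst y"
      "length (reduce (inverse_word h @ V x @ h)) + length (reduce (inverse_word h
        @ inverse_word (V x) @ V y @ h)) < length (V x) + length (V y)"
      by blast
    obtain V' where V': "basis V'" "normal_form (substitute V') \<Longrightarrow> normal_form (substitute V)"
      "V' x = reduce (inverse_word h @ V x @ h)"
        "V' y = reduce (inverse_word h @ inverse_word (V x) @ V y @ h)"
      using nielsen_step[OF less.prems xy(1), of h] by blast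
    have "equivariant V'" using V'(1) by (simp add: basis_def)
    from size[OF this xy(1)] size[OF eq xy(1)] xy(2)
    have "length (V' (GenA, True)) + length (V' (GenB, True)) < length (V (GenA, True))
      + length (V (GenB, True))"
      by (simp only: V'(3,4))
    then have "normal_form (substitute V')" using V'(1) by (rule less.hyps)
    then show ?thesis by (rule V'(2))
  next
    case False
    then have irred: "length (V x) + length (V y) \<le>
        length (reduce (inverse_word h @ V x @ h)) + length (reduce (inverse_word h
          @ inverse_word (V x) @ V y @ h))"
      if "fst x \<noteq> fst y" for x y h using that by (meson not_le)
    \<comment> \<open>The move without conjugation cancels a common prefix twice.\<close>
    have N1: "2 * lcp (V x) (V y) \<le> length (V x)" if xy: "fst x \<noteq> fst y" for x y
    proof -
      obtain c u v where c: "V x = c @ u" "V y = c @ v" "length c = lcp (V x) (V y)"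
        by (rule lcp_split)
      have "inverse_word (V x) @ V y \<simeq> inverse_word u @ v"
        using free_eq_cancel(2)[of "inverse_word u" c v] by (simp add: c(1,2))
      then have "reduce (inverse_word (V x) @ V y) = reduce (inverse_word u @ v)"
        by (simp add: free_eq_def)
      then have "length (reduce (inverse_word (V x) @ V y)) \<le> length u + length v"
        using length_reduce_le[of "inverse_word u @ v"] by simp
      moreover have "reduce (V x) = V x" using red by (rule reduce_reduced)
      ultimately have "length (V y) \<le> length u + length v" using irred[OF xy, of "[]"] by simp
      moreover have "length (V x) = length c + length u" "length (V y) = length c + length v"
        using c(1,2) by simp_all
      ultimately show ?thesis using c(3) by simp
    qed
    \<comment> \<open>If exactly half of \<open>V x\<close> is shared on both sides, then \<open>V x\<close> is \<open>c d\<close>-inverse and \<open>V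
       y\<close> is \<open>c z d\<close>-inverse. The move turns \<open>V y\<close> into \<open>d z d\<close>-inverse, and conjugation by
       \<open>d\<close> leaves \<open>z\<close>.\<close>
    have N2: False if xy: "fst x \<noteq> fst y" "2 * lcp (V y) (V x) = length (V x)"
      "2 * lcp (V (inv_letter x)) (V (inv_letter y)) = length (V x)" for x y
    proof -
      obtain c u v where c: "V y = c @ v" "V x = c @ u" "length c = lcp (V y) (V x)"
        by (rule lcp_split)
      obtain d a b where d: "V (inv_letter x) = d @ a" "V (inv_letter y) = d @ b"
        "length d = lcp (V (inv_letter x)) (V (inv_letter y))" by (rule lcp_split)
      have Vx: "V x = inverse_word a @ inverse_word d"
        and Vy: "V y = inverse_word b @ inverse_word d"
        using Vinv[of x] Vinv[of y] d(1,2) by (metis inverse_word_simps(3,4))+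
      have cd: "length c = length d" "length (V x) = length c + length d"
        using c(3) d(3) xy(2,3) by simp_all
      have "length (V x) \<le> length (V y)" using N1[of y x] xy(1,2) by (metis lcp_commute)
      have "length (inverse_word a) = length c"
        using Vx cd by (metis add_right_cancel length_append inverse_word_simps(5))
      then have "inverse_word a = c" using Vx c(2) by (metis append_eq_append_conv)
      obtain z where z: "inverse_word b = c @ z"
      proof -
        have "length c \<le> length (inverse_word b)" using \<open>length (V x) \<le> length (V y)\<close> Vy cd by simp
        then have "take (length c) (inverse_word b) = take (length c) (V y)" using Vy by simp
        also have "\<dots> = c" using c(1) by simp
        finally show thesis using that by (metis append_take_drop_id)
      qed
      have "reduce (inverse_word d @ V x @ d) = reduce (inverse_word d @ c)"
        using free_eq_cancel(2)[of "inverse_word d @ c" d "[]"] by (simp add: Vx \<open>inverse_word a = c\<close> free_eq_def)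
      then have 1: "length (reduce (inverse_word d @ V x @ d)) \<le> length (V x)"
        using length_reduce_le[of "inverse_word d @ c"] cd by simp
      have "inverse_word d @ inverse_word (V x) @ V y @ d
        = inverse_word d @ (d @ inverse_word c @ c @ z @ inverse_word d @ d)"
        by (simp add: Vx Vy z \<open>inverse_word a = c\<close>)
      also have "\<dots> \<simeq> inverse_word c @ c @ z @ inverse_word d @ d"
        using free_eq_cancel(2)[of "[]" d] by simp
      also have "\<dots> \<simeq> z @ inverse_word d @ d" using free_eq_cancel(2)[of "[]" c] by simp
      also have "\<dots> \<simeq> z" using free_eq_cancel(2)[of z d "[]"] by simp
      finally have "reduce (inverse_word d @ inverse_word (V x) @ V y @ d) = reduce z"
        by (simp add: free_eq_def)
      then have 2: "length (reduce (inverse_word d @ inverse_word (V x) @ V y @ d)) \<le> length z"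
        using length_reduce_le[of z] by simp
      have "length (V y) = length (V x) + length z" using Vy z cd by simp
      then have "length (V x) = 0" using irred[OF xy(1), of d] 1 2 by linarith
      then show False using ne by simp
    qed
    have cond: "lcp (V y) (V x) + lcp (V (inv_letter x)) (V z) < length (V x)"
      if yz: "y \<noteq> x" "z \<noteq> inv_letter x" for x y z
    proof -
      have self: "2 * lcp (V x) (V (inv_letter x)) < length (V x)" for x
        using lcp_inverse_word[OF red ne] by (simp add: Vinv)
      have len: "length (V (inv_letter x)) = length (V x)" by (simp add: Vinv)
      have same_gen: "fst a = fst b \<Longrightarrow> a \<noteq> b \<Longrightarrow> a = inv_letter b" for a b :: "gen2 letter"
        by (cases a; cases b) auto
      have A: "2 * lcp (V y) (V x) < length (V x) \<or> fst y \<noteq> fst x \<and> 2 * lcp (V y) (V x) \<le> length (V x)"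
      proof (cases "fst y = fst x")
        case True
        then have "y = inv_letter x" using yz(1) by (rule same_gen)
        then show ?thesis using self[of x] lcp_commute[of "V x"] by simp
      next
        case False
        then show ?thesis using N1[of x y] lcp_commute[of "V x"] by auto
      qed
      have B: "2 * lcp (V (inv_letter x)) (V z) < length (V x) \<or>
          fst z \<noteq> fst x \<and> 2 * lcp (V (inv_letter x)) (V z) \<le> length (V x)"
      proof (cases "fst z = fst x")
        case True
        then have "z = inv_letter (inv_letter x)" using yz(2) by (intro same_gen) auto
        then show ?thesis using self[of "inv_letter x"] len by simp
      next
        case False
        then show ?thesis using N1[of "inv_letter x" z] len by auto
      qed
      have False if "2 * lcp (V y) (V x) = length (V x)" "fst y \<noteq> fst x"
        "2 * lcp (V (inv_letter x)) (V z) = length (V x)" "fst z \<noteq> fst x"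
      proof (cases "z = y")
        case False
        have "fst z = fst y" using that(2,4) neq_iff_other by metis
        then have "z = inv_letter y" using False by (rule same_gen)
        then show False using N2[of x y] that by auto
      next
        case True
        obtain c u v where c: "V y = c @ v" "V x = c @ u" "length c = lcp (V y) (V x)"
          by (rule lcp_split)
        obtain d a b where d: "V (inv_letter x) = d @ a" "V y = d @ b"
          "length d = lcp (V (inv_letter x)) (V y)" by (rule lcp_split)
        have "length c = length d" using c(3) d(3) that(1,3) True by simp
        then have "c = d" using c(1) d(2) by (metis append_eq_append_conv)
        have "lcp (V x) (V (inv_letter x)) \<ge> length c"
        proof -
          have "length c \<le> lcp (c @ u) (c @ a)" by (induction c) auto
          then show ?thesis by (simp add: c(2) d(1) \<open>c = d\<close>)
        qed
        then show False using self[of x] c(3) that(1) by simp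
      qed
      then show ?thesis using A B by fastforce
    qed
    have letter: "\<exists>d. V d = [c]" for c
    proof -
      obtain w where w: "substitute V w \<simeq> [c]" using less.prems unfolding basis_def by blast
      have w': "substitute V (reduce w) \<simeq> [c]" using free_eq_trans[OF substitute_reduce[OF eq] w] .
      have "reduced [c]" by (simp add: reduced_Cons)
      then have "reduce (substitute V (reduce w)) = [c]"
        using w' by (metis free_eq_def reduce_reduced)
      then have "length (reduce w) \<le> 1"
        using nielsen_length[OF eq red cond, of "reduce w"] by (simp add: reduced_reduce)
      moreover have "reduce w \<noteq> []" using \<open>reduce (substitute V (reduce w)) = [c]\<close> by (auto simp: reduce_def)
      ultimately obtain d where "reduce w = [d]" by (cases "reduce w") auto
      then have "V d = [c]" using \<open>reduce (substitute V (reduce w)) = [c]\<close> red by (simp add: reduce_reduced)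
      then show ?thesis by blast
    qed
    then obtain d where d: "\<And>c. V (d c) = [c]" by metis
    have "inj d" by (rule injI) (metis d list.inject)
    then have "surj d" using finite_letters by (simp add: finite_UNIV_inj_surj)
    define m where "m x = hd (V x)" for x
    have m: "V x = [m x]" for x
      using \<open>surj d\<close> d unfolding m_def by (metis list.sel(1) surj_def)
    have "inj m"
    proof (rule injI)
      fix x y assume "m x = m y"
      obtain a b where "x = d a" "y = d b" using \<open>surj d\<close> by (metis surj_def)
      then show "x = y" using \<open>m x = m y\<close> d by (simp add: m_def)
    qed
    then have "bij m" using finite_letters by (simp add: bij_def finite_UNIV_inj_surj)
    moreover have "m (inv_letter x) = inv_letter (m x)" for x
      using Vinv[of x] by (simp add: m)
    ultimately have "normal_form (map m)" by (intro normal_form_signed) (simp add: signed_def)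
    moreover have "V = (\<lambda>x. [m x])" using m by (rule ext)
    then have "substitute V = map m" by (intro ext) (simp only: substitute_single)
    ultimately show ?thesis by simp
  qed
qed

section \<open>Automorphisms of the free group of rank two\<close>

lemma F2_simps [simp]:
  "carrier free_group = {w. reduced w}" "u \<otimes>\<^bsub>free_group\<^esub> v = reduce (u @ v)"
  by (simp_all add: free_group_def)

lemma reduced_single [simp]: "reduced [x]"
  by (simp add: reduced_Cons)

lemma reduce_Nil: "reduce [] = []"
  by (simp add: reduce_def)

lemma auto_basis:
  assumes "\<phi> \<in> auto F2"
  defines "V \<equiv> \<lambda>x. \<phi> [x]"
  shows "basis V" and "reduced w \<Longrightarrow> \<phi> w = reduce (substitute V w)"
proof -
  have red: "reduced (\<phi> w)" and mult: "reduced v \<Longrightarrow> \<phi> (reduce (w @ v)) = reduce (\<phi> w @ \<phi> v)"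
    if "reduced w" for w v
    using assms(1) that by (auto simp: auto_def hom_def Pi_iff)
  have bij: "bij_betw \<phi> {w. reduced w} {w. reduced w}"
    using assms(1) by (auto simp: auto_def Bij_def)
  have one: "\<phi> [] = []"
  proof -
    have "\<phi> [] @ \<phi> [] \<simeq> \<phi> []"
      using mult[of "[]" "[]"] red[of "[]"] by (simp add: free_eq_def reduce_reduced)
    then have "\<phi> [] \<simeq> []"
      using inverse_word_left[of "\<phi> []"] by (auto simp: free_eq_move_left intro: free_eq_trans)
    then show ?thesis using red[of "[]"] by (intro free_eq_reduced) auto
  qed
  have V: "\<phi> w = reduce (substitute V w)" if "reduced w" for w
    using that
  proof (induction w)
    case (Cons a w)
    then have w: "reduced w" and aw: "reduce ([a] @ w) = a # w"
      using reduce_reduced[of "a # w"] by (simp_all add: reduced_Cons)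
    have "\<phi> (a # w) = reduce (V a @ reduce (substitute V w))"
      using mult[of "[a]" w] w aw Cons.IH by (simp add: V_def)
    then show ?case by (simp add: reduce_append_reduce_right)
  qed (simp add: one reduce_def)
  then show "reduced w \<Longrightarrow> \<phi> w = reduce (substitute V w)" .
  have "equivariant V"
    unfolding equivariant_def
  proof
    fix x :: "gen2 letter"
    have "reduce ([x] @ [inv_letter x]) = []" by (simp add: reduce_def)
    then have "V x @ V (inv_letter x) \<simeq> []"
      using mult[of "[x]" "[inv_letter x]"] one by (simp add: V_def free_eq_def reduce_def)
    then have "V (inv_letter x) \<simeq> inverse_word (V x)" by (simp add: free_eq_move_left)
    then show "V (inv_letter x) = inverse_word (V x)"
      using red by (intro free_eq_reduced) (auto simp: V_def)
  qed
  moreover have "w \<simeq> []" if "substitute V w \<simeq> []" for w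
  proof -
    have "substitute V (reduce w) \<simeq> []" using substitute_reduce[OF \<open>equivariant V\<close>] that by (rule free_eq_trans)
    then have "\<phi> (reduce w) = \<phi> []"
      using V[OF reduced_reduce[of w]] one by (simp add: free_eq_def reduce_Nil)
    then have "reduce w = []"
      using bij reduced_reduce[of w] unfolding bij_betw_def by (auto dest: inj_onD)
    then show ?thesis by (simp add: free_eq_def reduce_def)
  qed
  moreover have "\<exists>w. substitute V w \<simeq> [x]" for x
  proof -
    have "[x] \<in> \<phi> ` {w. reduced w}" using bij by (simp add: bij_betw_def)
    then obtain w where "reduced w" "\<phi> w = [x]" by auto
    then have "substitute V w \<simeq> [x]" using V by (metis free_eq_reduce(2))
    then show ?thesis by blast
  qed
  ultimately show "basis V" using red by (simp add: basis_def V_def)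
qed

lemma basis_auto:
  assumes V: "basis V"
  shows "restrict (\<lambda>w. reduce (substitute V w)) {w. reduced w} \<in> auto F2"
proof -
  have eq: "equivariant V" using V by (simp add: basis_def)
  let ?f = "\<lambda>w. reduce (substitute V w)"
  have mult: "?f (reduce (u @ v)) = reduce (?f u @ ?f v)" for u v
    using substitute_reduce[OF eq, of "u @ v"]
    by (simp add: free_eq_def reduce_append_reduce_left reduce_append_reduce_right)
  have "bij_betw ?f {w. reduced w} {w. reduced w}"
    unfolding bij_betw_def
  proof
    show "inj_on ?f {w. reduced w}"
    proof (rule inj_onI)
      fix u v assume uv: "u \<in> {w. reduced w}" "v \<in> {w. reduced w}" "?f u = ?f v"
      then have "substitute V u \<simeq> substitute V v" by (simp add: free_eq_def)
      then have "substitute V u @ inverse_word (substitute V v) \<simeq> []"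
        by (simp add: free_eq_move_right)
      then have "substitute V (u @ inverse_word v) \<simeq> []"
        by (simp add: substitute_inverse_word[OF eq])
      then have "u @ inverse_word v \<simeq> []" using V unfolding basis_def by blast
      then have "u \<simeq> v" by (simp add: free_eq_move_right)
      then show "u = v" using uv by (simp add: free_eq_def reduce_reduced)
    qed
    show "?f ` {w. reduced w} = {w. reduced w}"
    proof (intro equalityI subsetI)
      fix u :: "gen2 letter list" assume u: "u \<in> {w. reduced w}"
      obtain w where w: "substitute V w \<simeq> u" using basis_surj[OF V] by blast
      then have "substitute V (reduce w) \<simeq> u" using substitute_reduce[OF eq] free_eq_trans by blast
      then have "?f (reduce w) = u" using u by (simp add: free_eq_def reduce_reduced)
      then show "u \<in> ?f ` {w. reduced w}"
        using reduced_reduce[of w] by (metis imageI mem_Collect_eq)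
    qed (auto simp: reduced_reduce)
  qed
  then have "bij_betw (restrict ?f {w. reduced w}) {w. reduced w} {w. reduced w}"
    using bij_betw_cong[of "{w. reduced w}" "restrict ?f {w. reduced w}" ?f] by simp
  then show ?thesis
    using mult by (auto simp: auto_def hom_def Bij_def reduced_reduce)
qed

text \<open>
  Positive paths are induced by automorphisms; together with signed permutations and conjugations
  this transfers minimality under the automorphism group to \<open>never_shorter\<close>.
\<close>

lemma positive_path_basis: "\<exists>V. basis V \<and> (\<forall>w. substitute V w \<simeq> positive_path gs w)"
proof (induction gs)
  case Nil
  have "basis (\<lambda>x. [x])" by (auto simp: basis_def equivariant_def)
  then show ?case by (intro exI[of _ "\<lambda>x. [x]"]) simp
next
  case (Cons g gs)
  then obtain V where V: "basis V" "\<And>w. substitute V w \<simeq> positive_path gs w" by blast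
  have "substitute (\<lambda>x. reduce (inverse_word [] @ substitute V (twist g 1 x) @ [])) w
    \<simeq> positive_path (g # gs) w" for w
    using free_eq_trans[OF nielsen_twist(1)[OF V(1), where g = g and s = 1 and h = "[]"
      and w = w]] V(2) by simp
  with nielsen_twist(2)[OF V(1), where g = g and s = 1 and h = "[]"] show ?case by blast
qed

lemma signed_basis:
  assumes V: "basis V" and m: "signed m"
  shows "basis (\<lambda>x. V (m x))"
proof -
  have substitute: "substitute (\<lambda>x. V (m x)) w = substitute V (map m w)" for w
    by (simp add: substitute_map)
  have bij: "bij m" and inv: "\<And>x. m (inv_letter x) = inv_letter (m x)"
    using m by (auto simp only: signed_def)
  have "equivariant (\<lambda>x. V (m x))" using V inv unfolding basis_def equivariant_def by metis
  moreover have "w \<simeq> []" if "substitute V (map m w) \<simeq> []" for w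
  proof -
    have "map m w \<simeq> []" using V that unfolding basis_def by blast
    moreover have "signed (inv_into UNIV m)"
    proof -
      have "inv_into UNIV m (inv_letter x) = inv_letter (inv_into UNIV m x)" for x
        using inv bij by (metis bij_inv_eq_iff)
      then show ?thesis using bij by (auto simp only: signed_def bij_imp_bij_inv)
    qed
    moreover have "map (inv_into UNIV m) (map m w) = w" using bij by (simp add: bij_def o_def)
    ultimately have "w \<sim> []"
      using map_signed_conj[of "inv_into UNIV m" "map m w" "[]"] free_eq_imp_conj by fastforce
    then show ?thesis by (simp only: conjugate_Nil)
  qed
  moreover have "\<exists>w. substitute V (map m w) \<simeq> [x]" for x
  proof -
    obtain w where "substitute V w \<simeq> [x]" using V unfolding basis_def by blast
    moreover have "w = map m (map (inv_into UNIV m) w)"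
      using bij by (simp add: bij_def o_def surj_f_inv_f)
    ultimately show ?thesis by metis
  qed
  ultimately show ?thesis using V unfolding basis_def substitute by blast
qed

lemma minimal_never_shorter:
  assumes u: "reduced u" and min: "\<forall>\<phi> \<in> auto F2. length u \<le> length (\<phi> u)"
    and \<tau>: "signed \<tau>"
  shows "never_shorter (length u) (map \<tau> u)"
  unfolding never_shorter_def
proof
  fix gs
  obtain z where z: "cyclically_reduced z" "z \<sim> positive_path gs (map \<tau> u)"
    using cyclic_reduction_exists by blast
  then obtain h where h: "z \<simeq> h @ positive_path gs (map \<tau> u) @ inverse_word h"
    by (auto simp: conjugate_def)
  obtain V where V: "basis V" "\<And>w. substitute V w \<simeq> positive_path gs w"
    using positive_path_basis by blast
  define W where "W = (\<lambda>x. V (\<tau> x))"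
  have W: "basis W" "\<And>w. substitute W w = substitute V (map \<tau> w)"
    using signed_basis[OF V(1) \<tau>] by (simp_all add: W_def substitute_map)
  define W' where "W'
    = (\<lambda>x. reduce (inverse_word (inverse_word h) @ substitute W (twist GenA 0 x) @ inverse_word h))"
  have W': "basis W'" "substitute W' u \<simeq> h @ substitute W u @ inverse_word h"
    using nielsen_twist(1,2)[OF W(1), where g = GenA and s = 0 and h = "inverse_word h"]
      by (simp_all add: W'_def)
  have "h @ substitute W u @ inverse_word h \<simeq> h @ positive_path gs (map \<tau> u) @ inverse_word h"
    unfolding W(2) by (intro free_eq_append V(2) free_eq_refl)
  then have "substitute W' u \<simeq> z" using W'(2) h by (blast intro: free_eq_trans free_eq_sym)
  then have "reduce (substitute W' u) = z"
    using cyclically_reduced_reduced[OF z(1)] by (simp add: free_eq_def reduce_reduced)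
  then have "length u \<le> length z" using bspec[OF min basis_auto[OF W'(1)]] u by simp
  then show "length u \<le> cyclic_length (positive_path gs (map \<tau> u))"
    using cyclic_length_eq[OF z] by simp
qed

section \<open>Counting\<close>

lemma reduced_map_signed: "signed m \<Longrightarrow> reduced (map m w) \<longleftrightarrow> reduced w"
proof -
  assume m: "signed m"
  have "m b = inv_letter (m a) \<longleftrightarrow> b = inv_letter a" for a b
    using m unfolding signed_def by (metis bij_def injD)
  then show ?thesis by (simp add: reduced_def successively_map)
qed

lemma cyclic_length_map_signed:
  assumes m: "signed m"
  shows "cyclic_length (map m w) = cyclic_length w"
proof -
  obtain v where v: "cyclically_reduced v" "v \<sim> w" using cyclic_reduction_exists by blast
  have "cyclically_reduced (map m v)"
    using v(1) reduced_map_signed[OF m, of "v @ take 1 v"]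
      by (simp add: cyclically_reduced_def take_map)
  from cyclic_length_eq[OF this map_signed_conj[OF m v(2)]] cyclic_length_eq[OF v] show ?thesis
    by simp
qed

lemma card_letters: "card (UNIV :: gen2 letter set) = 4"
proof -
  have "(UNIV :: gen2 set) = {GenA, GenB}" by (auto intro: gen2.exhaust)
  then have "card (UNIV :: gen2 set) = card {GenA, GenB}" by (rule arg_cong)
  also have "\<dots> = 2" by simp
  finally show ?thesis
    using card_cartesian_product[of "UNIV :: gen2 set" "UNIV :: bool set"] by simp
qed

lemma card_signed: "finite (Collect signed)" "card (Collect signed) \<le> 16"
proof -
  let ?f = "\<lambda>m :: gen2 letter \<Rightarrow> gen2 letter. (m (GenA, True), m (GenB, True))"
  have inj: "inj_on ?f (Collect signed)"
  proof (rule inj_onI, rule ext)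
    fix m n x assume mn: "m \<in> Collect signed" "n \<in> Collect signed" "?f m = ?f n"
    have "m (g, False) = inv_letter (m (g, True))" "n (g, False) = inv_letter (n (g, True))" for g
      using mn(1,2) unfolding signed_def mem_Collect_eq by (metis inv_letter.simps)+
    then show "m x = n x" using mn(3) by (cases x; cases "fst x"; cases "snd x") auto
  qed
  have fin: "finite (UNIV :: (gen2 letter \<times> gen2 letter) set)"
    using finite_letters by (simp add: finite_prod)
  show "finite (Collect signed)" using inj_on_finite[OF inj _ fin] by simp
  have "card (Collect signed) \<le> card (UNIV :: (gen2 letter \<times> gen2 letter) set)"
    using card_inj_on_le[OF inj _ fin] by simp
  also have "\<dots> = 16"
    using card_cartesian_product[of "UNIV :: gen2 letter set" "UNIV :: gen2 letter set"]
      by (simp add: card_letters)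
  finally show "card (Collect signed) \<le> 16" .
qed

text \<open>
  One word for each choice of the two signed permutations, the generators and exponents of the
  twists in \<open>flat_paths\<close>, and a rotation of a fixed cyclically reduced representative. The flag
  \<open>b\<close> says whether the final single twist is present; \<open>{..length u}\<close> rather than \<open>{..<length u}\<close>
  keeps the empty word.
\<close>

definition candidates :: "gen2 letter list \<Rightarrow> gen2 letter list set" where
  "candidates u = (\<lambda>(\<sigma>, \<tau>, g, h, b, k, i).
     rotate i (SOME v. cyclically_reduced v \<and>
       v \<sim> map \<sigma> (substitute (twist h (if b then 1 else 0)) (substitute (twist g (int k)) (map \<tau> u))))) `
     (Collect signed \<times> Collect signed \<times> {GenA, GenB} \<times> {GenA, GenB} \<times> UNIV \<times>
       {..2 * length u} \<times> {..length u})"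

lemma card_candidates:
  "finite (candidates u)" "card (candidates u) \<le> 2048 * (2 * length u + 1) * (length u + 1)"
proof -
  let ?I = "Collect signed \<times> Collect signed \<times> {GenA, GenB} \<times> {GenA, GenB} \<times> (UNIV :: bool set) \<times>
       {..2 * length u} \<times> {..length u}"
  have fin: "finite ?I" using card_signed(1) by simp
  show "finite (candidates u)" unfolding candidates_def by (rule finite_imageI[OF fin])
  have "card (candidates u) \<le> card ?I" unfolding candidates_def by (rule card_image_le[OF fin])
  also have "\<dots> = card (Collect signed) * (card (Collect signed) *
      (2 * (2 * (2 * (Suc (2 * length u) * Suc (length u))))))"
  proof -
    have "card {GenA, GenB} = 2" by simp
    then show ?thesis by (simp only: card_cartesian_product card_UNIV_bool card_atMost)
  qed
  also have "\<dots>
    = (card (Collect signed) * card (Collect signed)) * (8 * (2 * length u + 1) * (length u + 1))"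
    by (simp only: mult.assoc[symmetric] Suc_eq_plus1 mult_numeral_left)
  also have "\<dots> \<le> (16 * 16) * (8 * (2 * length u + 1) * (length u + 1))"
    by (intro mult_mono card_signed(2)) auto
  finally show "card (candidates u) \<le> 2048 * (2 * length u + 1) * (length u + 1)"
    by (simp add: algebra_simps)
qed

text \<open>
  An image of the same length as \<open>u\<close> is again of minimal length in its conjugacy class, hence
  cyclically reduced, and the positive path in its normal form starts and ends at that length.
\<close>

lemma orbit_candidates:
  assumes u: "reduced u" and min: "\<forall>\<phi> \<in> auto F2. length u \<le> length (\<phi> u)"
    and \<phi>: "\<phi> \<in> auto F2" and len: "length (\<phi> u) = length u"
  shows "\<phi> u \<in> candidates u"
proof -
  define V where "V = (\<lambda>x. \<phi> [x])"
  define n where "n = length u"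
  have V: "basis V" "\<phi> u = reduce (substitute V u)"
    by (fact auto_basis(1)[OF \<phi>, folded V_def], fact auto_basis(2)[OF \<phi> u, folded V_def])
  obtain \<sigma> \<tau> gs where normal_form: "signed \<sigma>" "signed \<tau>"
    "substitute V u \<sim> map \<sigma> (positive_path gs (map \<tau> u))"
    using normal_form_basis[OF V(1)] unfolding normal_form_def by blast
  define w where "w = map \<tau> u"
  have conj: "\<phi> u \<sim> map \<sigma> (positive_path gs w)"
    unfolding V(2) w_def by (rule conjugate_free_eq_trans(2)[OF free_eq_reduce(1) normal_form(3)])
  have never_shorter: "never_shorter n w"
    unfolding n_def w_def by (rule minimal_never_shorter[OF u min normal_form(2)])
  have red: "reduced (\<phi> u)" using V(2) by (simp add: reduced_reduce)
  have "cyclic_length w \<le> n"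
    using cyclic_length_le[of w] u normal_form(2) by (simp add: w_def n_def reduced_map_signed)
  moreover have "n \<le> cyclic_length w"
    using never_shorter unfolding never_shorter_def by (metis positive_path.simps(1))
  ultimately have cyclic_length_w: "cyclic_length w = n" by simp
  have cyclic_length_eq: "cyclic_length (positive_path gs w) = cyclic_length (\<phi> u)"
    using cyclic_length_conj[OF conj] cyclic_length_map_signed[OF normal_form(1)] by simp
  have "n \<le> cyclic_length (positive_path gs w)" using never_shorter by (simp add: never_shorter_def)
  then have n: "cyclic_length (positive_path gs w) = n" "cyclic_length (\<phi> u) = length (\<phi> u)"
    using cyclic_length_eq cyclic_length_le[OF red] len by (simp_all add: n_def)
  have cyc: "cyclically_reduced (\<phi> u)" using cyclically_reduced_if_cyclic_length[OF red n(2)] .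
  obtain g h k where k: "0 \<le> k" "k \<le> 2 * int n"
    "positive_path gs w \<sim> substitute (twist g k) w \<or> positive_path gs w
      \<sim> substitute (twist h 1) (substitute (twist g k) w)"
    by (rule flat_paths[OF never_shorter cyclic_length_w n(1)])
  obtain j where j: "k = int j" using k(1) by (metis nonneg_int_cases)
  obtain b where b: "positive_path gs w
    \<sim> substitute (twist h (if b then 1 else 0)) (substitute (twist g (int j)) w)"
  proof (cases "positive_path gs w \<sim> substitute (twist g k) w")
    case True
    then show thesis using that[of False] by (simp add: j)
  next
    case False
    then show thesis using k(3) that[of True] by (simp add: j)
  qed
  define x where "x = map \<sigma> (substitute (twist h (if b then 1 else 0)) (substitute (twist g (int j)) w))"
  have \<phi>x: "\<phi> u \<sim> x"
    unfolding x_def by (rule conjugate_trans[OF conj map_signed_conj[OF normal_form(1) b]])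
  define r where "r = (SOME v. cyclically_reduced v \<and> v \<sim> x)"
  have r: "cyclically_reduced r" "r \<sim> x"
    using someI_ex[OF cyclic_reduction_exists[of x]] by (simp_all add: r_def)
  obtain i where "\<phi> u = rotate i r"
    by (rule cyclically_reduced_conj_rotate[OF cyc r(1) conjugate_trans[OF \<phi>x conjugate_sym[OF r(2)]]])
  then have "\<phi> u = rotate (i mod length r) r" "length r = n"
    using rotate_conv_mod[of i r] len by (simp_all add: n_def)
  moreover have "i mod length r \<le> n" if "n \<noteq> 0" using that \<open>length r = n\<close> by (simp add: less_imp_le)
  moreover have "\<exists>i' \<le> n. rotate (i mod length r) r = rotate i' r"
  proof (cases "n = 0")
    case True
    then show ?thesis using \<open>length r = n\<close> by auto
  next
    case False
    then show ?thesis using \<open>n \<noteq> 0 \<Longrightarrow> i mod length r \<le> n\<close> by blast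
  qed
  ultimately obtain i' where i': "i' \<le> n" "\<phi> u = rotate i' r" by metis
  have mem: "(\<sigma>, \<tau>, g, h, b, j, i') \<in> Collect signed \<times> Collect signed \<times> {GenA, GenB} \<times> {GenA, GenB} \<times> UNIV \<times>
       {..2 * length u} \<times> {..length u}"
    using normal_form(1,2) k(2) j i'(1) by (cases g; cases h) (auto simp: n_def)
  show ?thesis
    unfolding candidates_def i'(2) r_def x_def w_def by (rule image_eqI[OF _ mem]) simp
qed

theorem theorem1p2:
  shows "\<exists>p :: real poly. \<forall>u \<in> carrier F2.
    (\<forall>\<phi> \<in> auto F2. length (\<phi> u) \<ge> length u) \<longrightarrow>
      finite {v \<in> carrier F2. length v = length u \<and> (\<exists>\<phi> \<in> auto F2. v = \<phi> u)} \<and>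
      real (card {v \<in> carrier F2. length v = length u \<and> (\<exists>\<phi> \<in> auto F2. v = \<phi> u)})
        \<le> poly p (real (length u))"
proof (intro exI ballI impI)
  fix u
  assume u: "u \<in> carrier F2" and min: "\<forall>\<phi> \<in> auto F2. length (\<phi> u) \<ge> length u"
  let ?S = "{v \<in> carrier F2. length v = length u \<and> (\<exists>\<phi> \<in> auto F2. v = \<phi> u)}"
  have subset: "?S \<subseteq> candidates u"
    using orbit_candidates[of u] u min by auto
  have "card ?S \<le> card (candidates u)" using card_candidates(1) subset by (rule card_mono)
  also have "\<dots> \<le> 2048 * (2 * length u + 1) * (length u + 1)" by (rule card_candidates(2))
  finally have "real (card ?S) \<le> real (2048 * (2 * length u + 1) * (length u + 1))"
    by (simp only: of_nat_le_iff)
  also have "\<dots> = poly ([:2048:] * [:1, 2:] * [:1, 1:]) (real (length u))"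
    by (simp add: algebra_simps)
  finally show "finite ?S \<and> real (card ?S) \<le> poly ([:2048:] * [:1, 2:] * [:1, 1:]) (real (length u))"
    using finite_subset[OF subset card_candidates(1)] by blast
qed

end
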